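(* Assume GCH. If $X$ is a homogeneous compactum, then $\hat{\mathrm{F}}(X)=\chi(X)^+$.
   Context: GCH is the generalized continuum hypothesis. A compactum is a compact Hausdorff space. A space $X$ is homogeneous if for all $p,q\in X$ there is an autohomeomorphism $h$ of $X$ with $h(p)=q$. A transfinite sequence $\vec{p}$ in $X$ is free if $\overline{\{p_j:j<i\}}$ and $\overline{\{p_j:j\geq i\}}$ are disjoint for all $i$. $\hat{\mathrm{F}}(X)$ is the least cardinal $\kappa$ such that $X$ has no free sequence of length $\kappa$. The character $\chi(p,X)$ of a point $p$ is the cofinality of the set of neighborhoods of $p$ ordered by $\supseteq$ (equivalently, the least cardinality of a local base at $p$), where a neighborhood of $p$ is a set with $p$ in its interior; and $\chi(X)=\sup_{p\in X}\chi(p,X)$. $\mu^+$ denotes the cardinal successor of $\mu$.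
   Formalization: Finite spaces with at least two points are excluded, since the claim fails there: a discrete space with n ≥ 2 points is a homogeneous compactum with character 1 and free-sequence number n+1, which is not 2. *)

theory Defs
  imports "HOL-Analysis.Analysis"
begin

unbundle cardinal_syntax

text \<open>
  Cardinals are represented by cardinal orders (\<^const>\<open>Card_order\<close>), compared across types by
  \<open>=o\<close>, \<open>\<le>o\<close>, \<open><o\<close>.
\<close>

text \<open>
  \<open>2\<^sup>\<kappa> = \<kappa>\<^sup>+\<close> for every infinite cardinal \<open>\<kappa>\<close> realised by a set of type \<open>'b set\<close>.
  HOL cannot quantify over types inside a formula, so the generalized continuum hypothesis is
  stated relative to a type; each instance is a consequence of the full hypothesis.
\<close>

definition GCH :: "'b itself \<Rightarrow> bool" where
  "GCH TYPE('b) \<longleftrightarrow> (\<forall>A :: 'b set. infinite A \<longrightarrow> |Pow A| =o cardSuc |A| )"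

definition homogeneous_space :: "'a topology \<Rightarrow> bool" where
  "homogeneous_space X \<longleftrightarrow>
     (\<forall>p \<in> topspace X. \<forall>q \<in> topspace X. \<exists>h. homeomorphic_map X X h \<and> h p = q)"

definition least_card :: "('b rel \<Rightarrow> bool) \<Rightarrow> 'b rel" where
  "least_card P =
     (SOME r. Card_order r \<and> P r \<and> (\<forall>r'. Card_order r' \<and> P r' \<longrightarrow> r \<le>o r'))"

lemma least_card:
  fixes r0 :: "'b rel"
  assumes "Card_order r0" "P r0"
  shows "Card_order (least_card P)"
    and "P (least_card P)"
    and "\<And>r. Card_order r \<Longrightarrow> P r \<Longrightarrow> least_card P \<le>o r"
proof -
  let ?R = "{r :: 'b rel. Card_order r \<and> P r}"
  have "\<exists>r \<in> ?R. \<forall>r' \<in> ?R. r \<le>o r'"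
    using assms by (intro exists_minim_Card_order) auto
  then have "\<exists>r. Card_order r \<and> P r \<and> (\<forall>r'. Card_order r' \<and> P r' \<longrightarrow> r \<le>o r')"
    by auto
  from someI_ex [OF this]
  have *: "Card_order (least_card P) \<and> P (least_card P) \<and>
           (\<forall>r'. Card_order r' \<and> P r' \<longrightarrow> least_card P \<le>o r')"
    unfolding least_card_def .
  show "Card_order (least_card P)" and "P (least_card P)"
    and "\<And>r. Card_order r \<Longrightarrow> P r \<Longrightarrow> least_card P \<le>o r"
    using * by auto
qed

definition nbhds :: "'a topology \<Rightarrow> 'a \<Rightarrow> 'a set set" where
  "nbhds X p = {N. N \<subseteq> topspace X \<and> p \<in> X interior_of N}"

definition local_base :: "'a topology \<Rightarrow> 'a \<Rightarrow> 'a set set \<Rightarrow> bool" where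
  "local_base X p B \<longleftrightarrow> B \<subseteq> nbhds X p \<and> (\<forall>N \<in> nbhds X p. \<exists>V \<in> B. V \<subseteq> N)"

definition pt_character :: "'a topology \<Rightarrow> 'a \<Rightarrow> 'a set rel" where
  "pt_character X p = least_card (\<lambda>r. \<exists>B. local_base X p B \<and> r =o |B| )"

text \<open>The supremum of the characters of the points, as their least upper bound.\<close>

definition character :: "'a topology \<Rightarrow> 'a set rel" where
  "character X = least_card (\<lambda>r. \<forall>p \<in> topspace X. pt_character X p \<le>o r)"

text \<open>A sequence indexed by the well-order \<open>r\<close>; its values off \<^term>\<open>Field r\<close> are irrelevant.\<close>

definition free_sequence :: "'a topology \<Rightarrow> 'i rel \<Rightarrow> ('i \<Rightarrow> 'a) \<Rightarrow> bool" where
  "free_sequence X r p \<longleftrightarrow>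
     (\<forall>i \<in> Field r. p i \<in> topspace X) \<and>
     (\<forall>i \<in> Field r.
        disjnt (X closure_of (p ` {j. (j, i) \<in> r \<and> j \<noteq> i})) (X closure_of (p ` {j. (i, j) \<in> r})))"

text \<open>
  Free sequences in \<open>X\<close> are injective, so none has length the cardinality of \<open>'a set\<close>. Hence the
  least cardinal that is not the length of a free sequence is realised on the type \<open>'a set\<close>.
\<close>

definition F_hat :: "'a topology \<Rightarrow> 'a set rel" where
  "F_hat X = least_card (\<lambda>r. \<not> (\<exists>p. free_sequence X r p))"

lemma free_sequence_inj_on:
  assumes "Well_order r" "free_sequence X r p"
  shows "inj_on p (Field r)"
proof -
  have neq: "p i \<noteq> p j" if "(j, i) \<in> r" "j \<noteq> i" for i j
  proof
    assume eq: "p i = p j"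
    have F: "i \<in> Field r" "j \<in> Field r"
      using that by (auto simp: Field_def)
    then have "(i, i) \<in> r"
      using assms(1) unfolding order_on_defs refl_on_def by blast
    then have "p i \<in> X closure_of (p ` {j. (i, j) \<in> r})"
      using F assms(2) by (auto simp: free_sequence_def intro!: in_closure_of [THEN iffD2])
    moreover have "p i \<in> X closure_of (p ` {j. (j, i) \<in> r \<and> j \<noteq> i})"
      using F that eq assms(2)
      by (auto simp: free_sequence_def intro!: in_closure_of [THEN iffD2])
    ultimately show False
      using F assms(2) by (auto simp: free_sequence_def disjnt_iff)
  qed
  have "(i, j) \<in> r \<or> (j, i) \<in> r" if "i \<in> Field r" "j \<in> Field r" "i \<noteq> j" for i j
    using assms(1) that unfolding order_on_defs total_on_def by blast
  then show ?thesis
    using neq by (metis inj_onI)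
qed

lemma no_free_sequence_card_of_UNIV:
  fixes X :: "'a topology"
  shows "\<not> (\<exists>p. free_sequence X |UNIV :: 'a set set| p)"
proof
  assume "\<exists>p. free_sequence X |UNIV :: 'a set set| p"
  then obtain p where p: "free_sequence X |UNIV :: 'a set set| p" ..
  have "inj_on p (Field |UNIV :: 'a set set| )"
    using p card_of_Well_order free_sequence_inj_on by blast
  then have "|UNIV :: 'a set set| \<le>o |UNIV :: 'a set|"
    by (metis Field_card_of card_of_ordLeqI iso_tuple_UNIV_I)
  moreover have "|UNIV :: 'a set| <o |UNIV :: 'a set set|"
    using card_of_Pow [of "UNIV :: 'a set"] by simp
  ultimately show False
    using not_ordLess_ordLeq by blast
qed

end

theory Submission
  imports Defs
begin

text \<open>
  Let \<open>\<kappa> = \<chi>(X)\<close>. A free sequence of length \<open>\<kappa>\<^sup>+\<close> would have a point in the closures of all its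
  final segments; a local base of size \<open>\<kappa>\<close> places that point in the closure of an initial segment.
  Conversely, suppose that there is no free sequence of length \<open>\<kappa>\<close>. Then \<open>\<pi>\<close>-characters are less than
  \<open>\<kappa>\<close>, and for some \<open>\<mu> < \<kappa>\<close> a nonempty intersection of \<open>\<mu>\<close> zero sets lies in the closure of \<open>\<mu>\<close>
  points. The character of a point of this intersection is at most \<open>2\<^sup>\<mu> = \<mu>\<^sup>+\<close>, so \<open>\<kappa> = \<mu>\<^sup>+ = 2\<^sup>\<mu>\<close>. By
  homogeneity such intersections cover \<open>X\<close>; this yields a dense set of size \<open>2\<^sup>\<mu>\<close>, and homogeneity
  with \<open>\<pi>\<close>-character at most \<open>\<mu>\<close> gives \<open>|X| \<le> 2\<^sup>\<mu> = \<kappa>\<close>. But a compactum all of whose points have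
  character at least the uncountable \<open>\<kappa>\<close> has more than \<open>\<kappa>\<close> points.
\<close>

subsection \<open>Cardinals and transfinite recursion\<close>

text \<open>Families of real functions carry the cardinal bookkeeping. When \<open>zeros X G\<close>
  is a single point, compactness turns \<open>G\<close> into a local base of size at most
  \<open>|G|\<close> plus countably many, so counting functions bounds characters. Functions also
  certify freeness, by being at least 2/3 on an initial segment and at most 1/3 on the rest. GCH
  acts on one squeeze: \<mu> is below \<kappa>, and one point has character at most
  \<open>2\<^sup>\<mu>\<close>. That \<kappa> is \<open>\<mu>\<^sup>+\<close> means that no free
  sequence has length \<open>\<mu>\<^sup>+\<close>, so a set is closed once it contains the closures
  of its subsets of size at most \<mu>; closing off under \<mu>-ary operations can handle such
  subsets. That \<kappa> is \<open>2\<^sup>\<mu>\<close> brings the bound on the size of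
  \<open>X\<close> into conflict with the bound from characters. Until the squeeze \<kappa> may be
  singular, so the recursions before it only use that proper initial segments are smaller than
  \<kappa>.\<close>

declare card_of_card_order_on [simp] card_of_well_order_on [simp] Field_card_of [simp]
  card_of_mono1 [OF subset_refl, simp]

lemma card_of_nat_ordLeq:
  assumes "Card_order r" "infinite (Field r)"
  shows "|UNIV :: nat set| \<le>o r"
  using assms card_of_Field_ordIso infinite_iff_card_of_nat ordLeq_ordIso_trans by blast

lemma card_of_finite_subsets:
  assumes r: "Card_order r" "infinite (Field r)" and A: "|A| \<le>o r"
  shows "|{a. finite a \<and> a \<subseteq> A}| \<le>o r"
proof -
  define L where "L n = {xs. set xs \<subseteq> A \<and> length xs = n}" for n :: nat
  have L: "|L n| \<le>o r" for n
  proof (induction n)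
    case 0
    have "L 0 = {[]}" by (auto simp: L_def)
    then show ?case
      using r by (metis Card_order_singl_ordLeq finite.emptyI)
  next
    case (Suc n)
    have "L (Suc n) \<subseteq> (\<lambda>(x, xs). x # xs) ` (A \<times> L n)"
    proof
      fix xs assume "xs \<in> L (Suc n)"
      then show "xs \<in> (\<lambda>(x, xs). x # xs) ` (A \<times> L n)"
        by (cases xs) (auto simp: L_def image_iff)
    qed
    then have "|L (Suc n)| \<le>o |A \<times> L n|"
      by (rule surj_imp_ordLeq)
    also have "|A \<times> L n| \<le>o r"
      using r A Suc by (metis card_of_Times_ordLeq_infinite_Field)
    finally show ?case .
  qed
  have "{a. finite a \<and> a \<subseteq> A} \<subseteq> set ` (\<Union>n\<in>UNIV. L n)"
    using finite_list by (fastforce simp: L_def image_iff)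
  then have "|{a. finite a \<and> a \<subseteq> A}| \<le>o |\<Union>n\<in>UNIV. L n|"
    by (rule surj_imp_ordLeq)
  also have "|\<Union>n\<in>UNIV. L n| \<le>o r"
    using r L card_of_nat_ordLeq[OF r] by (intro card_of_UNION_ordLeq_infinite_Field) auto
  finally show ?thesis .
qed

lemma card_of_finite_ordLess:
  assumes "Card_order r" "infinite (Field r)" "finite A"
  shows "|A| <o r"
  using assms finite_ordLess_infinite[OF card_of_Well_order[of A], of r]
  by (simp add: Field_card_of card_order_on_def)

lemma card_of_finite_subsets_ordLess:
  assumes r: "Card_order r" "infinite (Field r)" and A: "|A| <o r"
  shows "|{a. finite a \<and> a \<subseteq> A}| <o r"
proof (cases "finite A")
  case True
  then have "finite {a. finite a \<and> a \<subseteq> A}"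
    by simp
  then show ?thesis
    using card_of_finite_ordLess r by blast
next
  case False
  then have "|{a. finite a \<and> a \<subseteq> A}| \<le>o |A|"
    by (intro card_of_finite_subsets) auto
  then show ?thesis
    using A ordLeq_ordLess_trans by blast
qed

text \<open>The disjoint sum dominates both factors, so the product is bounded by an infinite
  cardinal below \<open>r\<close> without comparing \<open>A\<close> with \<open>B\<close>.\<close>

lemma card_of_Times_ordLess_infinite:
  assumes r: "Card_order r" "infinite (Field r)" and A: "|A| <o r" and B: "|B| <o r"
  shows "|A \<times> B| <o r"
proof (cases "finite (A <+> B)")
  case True
  then have "finite A" "finite B"
    by (auto simp: finite_Plus_iff)
  then show ?thesis
    by (intro card_of_finite_ordLess[OF r] finite_cartesian_product)
next
  case False
  have "|A \<times> B| \<le>o |A <+> B|"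
    using False by (intro card_of_Times_ordLeq_infinite_Field)
      (auto simp: card_of_Plus1 card_of_Plus2)
  moreover have "|A <+> B| <o r"
    using r A B by (intro card_of_Plus_ordLess_infinite_Field) auto
  ultimately show ?thesis
    by (rule ordLeq_ordLess_trans)
qed

section \<open>Arithmetic of \<open>2\<^sup>\<mu>\<close>, where \<mu> is the size of
  \<open>M\<close>\<close>

lemma card_of_Pow_mono:
  assumes "|A| \<le>o |B|"
  shows "|Pow A| \<le>o |Pow B|"
proof -
  obtain f where "inj_on f A" "f ` A \<subseteq> B"
    using assms card_of_ordLeq by metis
  then have "inj_on (image f) (Pow A)" "image f ` Pow A \<subseteq> Pow B"
    by (auto simp: inj_on_image_Pow)
  then show ?thesis
    by (metis card_of_ordLeq)
qed

lemma card_of_Pow_Times: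
  assumes "infinite M" "|A| \<le>o |M|" "|B| \<le>o |M|"
  shows "|Pow (A \<times> B)| \<le>o |Pow M|"
  using assms
  by (intro card_of_Pow_mono card_of_Times_ordLeq_infinite_Field)
    auto

text \<open>Currying: with \<open>D\<close> embedded in \<open>Pow M\<close>, a function on
  \<open>N\<close> becomes a relation between \<open>N\<close> and \<open>M\<close>.\<close>

lemma card_of_Func_Pow:
  assumes M: "infinite M" and N: "|N| \<le>o |M|" and D: "|D| \<le>o |Pow M|"
  shows "|Func N D| \<le>o |Pow M|"
proof -
  obtain e where e: "inj_on e D" "e ` D \<subseteq> Pow M"
    using D card_of_ordLeq by metis
  define code where "code f = {(n, m). n \<in> N \<and> m \<in> e (f n)}" for f
  have "inj_on code (Func N D)"
  proof (rule inj_onI)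
    fix f g assume f: "f \<in> Func N D" and g: "g \<in> Func N D" and eq: "code f = code g"
    have "f n = g n" if "n \<in> N" for n
    proof -
      have "e (f n) = e (g n)"
        using eq that by (auto simp: code_def)
      then show ?thesis
        using e f g that by (auto simp: Func_def dest: inj_onD)
    qed
    then show "f = g"
      using f g unfolding Func_def by (intro ext) (metis (mono_tags, lifting) mem_Collect_eq)
  qed
  moreover have "code ` Func N D \<subseteq> Pow (N \<times> M)"
    using e by (fastforce simp: code_def Func_def)
  ultimately have "|Func N D| \<le>o |Pow (N \<times> M)|"
    by (metis card_of_ordLeq)
  also have "|Pow (N \<times> M)| \<le>o |Pow M|"
    using M N by (intro card_of_Pow_Times) auto
  finally show ?thesis .
qed

text \<open>A nonempty subset of size at most \<mu> is the range of a function on \<open>M\<close>.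
  The empty set is no such range, since \<open>M\<close> is nonempty, and is added by hand.\<close>

lemma card_of_small_subsets:
  assumes M: "infinite M" and D: "|D| \<le>o |Pow M|"
  shows "|{A. A \<subseteq> D \<and> |A| \<le>o |M| }| \<le>o |Pow M|"
proof -
  have "{A. A \<subseteq> D \<and> |A| \<le>o |M| } \<subseteq> insert {} ((\<lambda>f. f ` M) ` Func M D)"
  proof clarify
    fix A assume A: "A \<subseteq> D" "|A| \<le>o |M|" and ne: "A \<notin> (\<lambda>f. f ` M) ` Func M D"
    show "A = {}"
    proof (rule ccontr)
      assume "A \<noteq> {}"
      then obtain f where f: "f ` M = A"
        using A card_of_ordLeq2 by metis
      define h where "h m = (if m \<in> M then f m else undefined)" for m
      have "h \<in> Func M D" "h ` M = A"
        using f A by (auto simp: h_def Func_def)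
      then show False
        using ne by blast
    qed
  qed
  then have "|{A. A \<subseteq> D \<and> |A| \<le>o |M| }| \<le>o |insert {} ((\<lambda>f. f ` M) ` Func M D)|"
    by (rule card_of_mono1)
  also have "|insert {} ((\<lambda>f. f ` M) ` Func M D)| \<le>o |Pow M|"
  proof -
    have "|{{}} \<union> (\<lambda>f. f ` M) ` Func M D| \<le>o |Pow M|"
    proof (rule card_of_Un_ordLeq_infinite_Field)
      show "|{{}}| \<le>o |Pow M|"
        by (metis Pow_not_empty card_of_singl_ordLeq)
      show "|(\<lambda>f. f ` M) ` Func M D| \<le>o |Pow M|"
        by (rule ordLeq_transitive[OF card_of_image card_of_Func_Pow[OF M _ D]]) simp
    qed (use M in \<open>auto simp: finite_Pow_iff\<close>)
    then show ?thesis by simp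
  qed
  finally show ?thesis .
qed

text \<open>Recursion with arbitrary choices. By \<open>adm\<close> the condition at
  \<open>i\<close> looks only at earlier values. Guarding it by \<open>i \<in> Field r\<close>
  reduces the claim to dependent choice along the strict part of \<open>r\<close>.\<close>

lemma transfinite_choice:
  fixes P :: "('i \<Rightarrow> 'b) \<Rightarrow> 'i \<Rightarrow> 'b \<Rightarrow> bool"
  assumes r: "Well_order r"
    and adm: "\<And>f g i y. (\<And>j. j \<in> underS r i \<Longrightarrow> f j = g j) \<Longrightarrow> P f i y = P g i y"
    and step: "\<And>f i. i \<in> Field r \<Longrightarrow> (\<And>j. j \<in> underS r i \<Longrightarrow> P f j (f j)) \<Longrightarrow> \<exists>y. P f i y"
  obtains f where "\<And>i. i \<in> Field r \<Longrightarrow> P f i (f i)"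
proof -
  have wf: "wf (r - Id)"
    using r by (simp add: well_order_on_def)
  have *: "j \<in> underS r i \<longleftrightarrow> (j, i) \<in> r - Id" for i j
    by (auto simp: underS_def)
  have "\<exists>f. \<forall>i. i \<in> Field r \<longrightarrow> P f i (f i)"
  proof (rule dependent_wf_choice[OF wf])
    fix f g :: "'i \<Rightarrow> 'b" and i y assume "\<And>z. (z, i) \<in> r - Id \<Longrightarrow> f z = g z"
    then show "(i \<in> Field r \<longrightarrow> P f i y) = (i \<in> Field r \<longrightarrow> P g i y)"
      using adm[of i f g y] * by auto
  next
    fix i and f :: "'i \<Rightarrow> 'b" assume "\<And>j. (j, i) \<in> r - Id \<Longrightarrow> j \<in> Field r \<longrightarrow> P f j (f j)"
    then show "\<exists>y. i \<in> Field r \<longrightarrow> P f i y"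
      using step[of i f] * by (auto simp: Field_def)
  qed
  then show thesis
    using that by blast
qed

lemma Well_order_induct [consumes 2, case_names less]:
  assumes r: "Well_order r" and i: "i \<in> Field r"
    and step: "\<And>i. i \<in> Field r \<Longrightarrow> (\<And>j. j \<in> underS r i \<Longrightarrow> P j) \<Longrightarrow> P i"
  shows "P i"
proof -
  have wf: "wf (r - Id)"
    using r by (simp add: well_order_on_def)
  show ?thesis
    using wf i
  proof (induction i rule: wf_induct_rule)
    case (less i)
    then show ?case
      by (elim step) (auto simp: underS_def Field_def)
  qed
qed

text \<open>Closure in the style of Loewenheim-Skolem. Iteration along \<open>\<mu>\<^sup>+\<close>
  suffices because successor cardinals are regular: a subset of the union of size at most \<mu>
  already lies in one stage. Stages stay within \<open>2\<^sup>\<mu>\<close> because a set of that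
  size has at most that many subsets of size at most \<mu>.\<close>

lemma closing_off:
  fixes M :: "'m set" and S :: "'b set"
  assumes M: "infinite M"
    and \<Phi>: "\<And>A. A \<subseteq> S \<Longrightarrow> |A| \<le>o |M| \<Longrightarrow> \<Phi> A \<subseteq> S \<and> |\<Phi> A| \<le>o |Pow M|"
  obtains D where "D \<subseteq> S" "|D| \<le>o |Pow M|" "\<And>A. A \<subseteq> D \<Longrightarrow> |A| \<le>o |M| \<Longrightarrow> \<Phi> A \<subseteq> D"
proof -
  define r where "r = cardSuc |M|"
  have r: "Card_order r"
    unfolding r_def by (simp add: cardSuc_Card_order)
  then have wo: "Well_order r"
    by (simp add: card_order_on_def)
  have infr: "infinite (Field r)"
    unfolding r_def by (simp add: M cardSuc_finite)
  have PM: "Card_order |Pow M|" "infinite (Field |Pow M| )"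
    using M by (auto simp: finite_Pow_iff)
  have rPow: "r \<le>o |Pow M|"
    unfolding r_def using card_of_Pow by (intro cardSuc_least) auto
  define B where "B f i = (\<Union>j\<in>underS r i. f j)" for f :: "'m set \<Rightarrow> 'b set" and i
  define T where "T E = E \<union> (\<Union>A\<in>{A. A \<subseteq> E \<and> |A| \<le>o |M| }. \<Phi> A)" for E
  obtain f where f: "\<And>i. i \<in> Field r \<Longrightarrow> f i = T (B f i)"
  proof (rule transfinite_choice[OF wo, of "\<lambda>f i y. y = T (B f i)"])
    fix f g :: "'m set \<Rightarrow> 'b set" and i y
    assume "\<And>j. j \<in> underS r i \<Longrightarrow> f j = g j"
    then have "B f i = B g i" by (simp add: B_def)
    then show "(y = T (B f i)) = (y = T (B g i))" by simp
  qed auto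
  have fS: "f i \<subseteq> S" if "i \<in> Field r" for i
    using wo that
  proof (induction rule: Well_order_induct)
    case (less i)
    then have "B f i \<subseteq> S" by (auto simp: B_def)
    then have "T (B f i) \<subseteq> S" using \<Phi> unfolding T_def by blast
    then show ?case using f less by simp
  qed
  have fcard: "|f i| \<le>o |Pow M|" if "i \<in> Field r" for i
    using wo that
  proof (induction rule: Well_order_induct)
    case (less i)
    have "underS r i \<subseteq> Field r"
      by (auto simp: underS_def Field_def)
    have "|underS r i| \<le>o r"
      using card_of_underS[OF r] less ordLess_imp_ordLeq by blast
    then have "|B f i| \<le>o |Pow M|"
      unfolding B_def using less PM rPow ordLeq_transitive
      by (intro card_of_UNION_ordLeq_infinite_Field) blast+
    moreover have "B f i \<subseteq> S"
      unfolding B_def using fS \<open>underS r i \<subseteq> Field r\<close> by blast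
    ultimately have "|T (B f i)| \<le>o |Pow M|"
      unfolding T_def using \<Phi> card_of_small_subsets[OF M] PM
      by (intro card_of_Un_ordLeq_infinite_Field card_of_UNION_ordLeq_infinite_Field) auto
    then show ?case using f less by simp
  qed
  define D where "D = (\<Union>i\<in>Field r. f i)"
  have chain: "relChain r f"
    unfolding relChain_def
  proof clarify
    fix i j x assume ij: "(i, j) \<in> r" and x: "x \<in> f i"
    show "x \<in> f j"
    proof (cases "i = j")
      case False
      then have "i \<in> underS r j" "j \<in> Field r"
        using ij by (auto simp: underS_def Field_def)
      then show ?thesis
        using x f[of j] by (auto simp: T_def B_def)
    qed (use x in simp)
  qed
  show thesis
  proof (rule that)
    show "D \<subseteq> S" using fS by (auto simp: D_def)
    show "|D| \<le>o |Pow M|"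
      unfolding D_def
    proof (rule card_of_UNION_ordLeq_infinite_Field)
      have "|Field r| \<le>o r"
        using r card_of_Field_ordIso ordIso_imp_ordLeq by blast
      then show "|Field r| \<le>o |Pow M|"
        using rPow ordLeq_transitive by blast
    qed (use PM fcard in auto)
    show "\<Phi> A \<subseteq> D" if A: "A \<subseteq> D" "|A| \<le>o |M|" for A
    proof -
      obtain i where i: "i \<in> Field r" "A \<subseteq> f i"
        using cardSuc_UNION[of "|M|" f A] A chain M unfolding D_def r_def
        by auto
      \<comment> \<open>\<open>\<Phi> A\<close> enters strictly after the stage containing
        \<open>A\<close>, so a later index is needed; an infinite cardinal has no last
        element.\<close>
      obtain j where j: "j \<in> Field r" "i \<noteq> j" "(i, j) \<in> r"
        using infinite_Card_order_limit[OF r infr i(1)] by blast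
      then have "A \<subseteq> B f j"
        using i by (auto simp: B_def underS_def)
      then have "\<Phi> A \<subseteq> f j"
        using f[OF j(1)] A by (auto simp: T_def)
      then show ?thesis
        using j by (auto simp: D_def)
    qed
  qed
qed

subsection \<open>Zero sets and free sequences\<close>

lemma finite_has_greatest:
  assumes r: "Well_order r" and J: "finite J" "J \<noteq> {}" "J \<subseteq> Field r"
  obtains k where "k \<in> J" "\<And>j. j \<in> J \<Longrightarrow> (j, k) \<in> r"
proof -
  have tr: "trans r" and tot: "total_on (Field r) r" and rf: "refl_on (Field r) r"
    using r unfolding order_on_defs by auto
  have rfl: "(j, j) \<in> r" if "j \<in> Field r" for j
    using rf that by (rule refl_onD)
  have "\<exists>k\<in>J. \<forall>j\<in>J. (j, k) \<in> r"
    using J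
  proof (induction J rule: finite_ne_induct)
    case (singleton x)
    then show ?case using rfl by auto
  next
    case (insert x F)
    then obtain k where k: "k \<in> F" "\<forall>j\<in>F. (j, k) \<in> r" by auto
    have xk: "x \<in> Field r" "k \<in> Field r" "x \<noteq> k"
      using insert k by auto
    then consider "(x, k) \<in> r" | "(k, x) \<in> r"
      using tot by (auto simp: total_on_def)
    then show ?case
    proof cases
      case 1
      then show ?thesis using k by auto
    next
      case 2
      then have "\<forall>j\<in>F. (j, x) \<in> r"
        using k tr by (meson transD)
      then show ?thesis using rfl xk by auto
    qed
  qed
  then show thesis using that by blast
qed

lemma Well_order_cases:
  assumes "Well_order r" "i \<in> Field r" "j \<in> Field r"
  obtains "j \<in> underS r i" "(i, j) \<notin> r" | "(i, j) \<in> r" "j \<notin> underS r i"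
proof -
  have as: "antisym r" and tot: "total_on (Field r) r" and rf: "refl_on (Field r) r"
    using assms(1) unfolding order_on_defs by auto
  show thesis
  proof (cases "(i, j) \<in> r")
    case True
    then have "j \<notin> underS r i"
      using as by (auto simp: underS_def dest: antisymD)
    then show thesis
      using that(2) True by blast
  next
    case False
    then have "i \<noteq> j"
      using refl_onD[OF rf assms(2)] by auto
    then have "j \<in> underS r i"
      using False tot assms(2,3) by (auto simp: underS_def total_on_def)
    then show thesis
      using that(1) False by blast
  qed
qed

text \<open>The closed sets of type \<open>G_\<mu>\<close> in the argument: each zero set is a
  countable intersection of open sets on which the function is small.\<close>

definition zeros :: "'a topology \<Rightarrow> ('a \<Rightarrow> real) set \<Rightarrow> 'a set" where
  "zeros X G = {x \<in> topspace X. \<forall>g\<in>G. g x = 0}"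

lemma
  assumes "continuous_map X euclideanreal g"
  shows closedin_le: "closedin X {x \<in> topspace X. g x \<le> c}"
    and closedin_ge: "closedin X {x \<in> topspace X. c \<le> g x}"
    and closedin_eq: "closedin X {x \<in> topspace X. g x = c}"
    and openin_less: "openin X {x \<in> topspace X. g x < c}"
    and openin_greater: "openin X {x \<in> topspace X. c < g x}"
  using closedin_continuous_map_preimage[OF assms, of "{..c}"]
    closedin_continuous_map_preimage[OF assms, of "{c..}"]
    closedin_continuous_map_preimage[OF assms, of "{c}"]
    openin_continuous_map_preimage[OF assms, of "{..<c}"]
    openin_continuous_map_preimage[OF assms, of "{c<..}"]
  by simp_all

lemma
  assumes "continuous_map X euclideanreal g"
  shows closedin_abs_le: "closedin X {x \<in> topspace X. \<bar>g x\<bar> \<le> c}"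
    and openin_abs_less: "openin X {x \<in> topspace X. \<bar>g x\<bar> < c}"
    and openin_abs_greater: "openin X {x \<in> topspace X. c < \<bar>g x\<bar>}"
  using assms by (intro closedin_le openin_less openin_greater continuous_map_real_abs; simp)+

lemma openin_finite_Ball:
  assumes "finite J" "\<And>j. j \<in> J \<Longrightarrow> openin X {x \<in> topspace X. P j x}"
  shows "openin X {x \<in> topspace X. \<forall>j\<in>J. P j x}"
  using assms
proof (induction J rule: finite_induct)
  case (insert j J)
  then have "openin X ({x \<in> topspace X. P j x} \<inter> {x \<in> topspace X. \<forall>j\<in>J. P j x})"
    by (intro openin_Int) auto
  also have "\<dots> = {x \<in> topspace X. \<forall>j\<in>insert j J. P j x}"
    by auto
  finally show ?case .
qed simp

text \<open>Weak inequalities pass to closures, and the gap between 1/3 and 2/3 keeps the two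
  closures apart. It also leaves room for strict inequalities at finite stages to become weak ones
  in a compactness argument.\<close>

lemma free_sequenceI:
  assumes r: "Well_order r" and p: "\<And>i. i \<in> Field r \<Longrightarrow> p i \<in> topspace X"
    and g: "\<And>i. i \<in> Field r \<Longrightarrow> continuous_map X euclideanreal (g i)"
    and lt: "\<And>i j. i \<in> Field r \<Longrightarrow> j \<in> underS r i \<Longrightarrow> g i (p j) \<ge> 2/3"
    and ge: "\<And>i j. (i, j) \<in> r \<Longrightarrow> g i (p j) \<le> 1/3"
  shows "free_sequence X r p"
  unfolding free_sequence_def
proof (intro conjI ballI)
  fix i assume i: "i \<in> Field r"
  have "X closure_of (p ` {j. (j, i) \<in> r \<and> j \<noteq> i}) \<subseteq> {x \<in> topspace X. 2/3 \<le> g i x}"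
  proof (rule closure_of_minimal)
    show "p ` {j. (j, i) \<in> r \<and> j \<noteq> i} \<subseteq> {x \<in> topspace X. 2/3 \<le> g i x}"
      using p lt[OF i] by (auto simp: underS_def Field_def)
  qed (intro closedin_ge g i)
  moreover have "X closure_of (p ` {j. (i, j) \<in> r}) \<subseteq> {x \<in> topspace X. g i x \<le> 1/3}"
  proof (rule closure_of_minimal)
    show "p ` {j. (i, j) \<in> r} \<subseteq> {x \<in> topspace X. g i x \<le> 1/3}"
      using p ge by (auto simp: Field_def)
  qed (intro closedin_le g i)
  ultimately show "disjnt (X closure_of (p ` {j. (j, i) \<in> r \<and> j \<noteq> i})) (X closure_of (p ` {j. (i, j) \<in> r}))"
    unfolding disjnt_iff by force
qed (use p in auto)

definition local_pi_base :: "'a topology \<Rightarrow> 'a \<Rightarrow> 'a set set \<Rightarrow> bool" where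
  "local_pi_base X p P \<longleftrightarrow>
     (\<forall>V\<in>P. openin X V \<and> V \<noteq> {}) \<and> (\<forall>N. openin X N \<and> p \<in> N \<longrightarrow> (\<exists>V\<in>P. V \<subseteq> N))"

section \<open>Separation, compactness and free sequences in a compactum\<close>

locale compactum =
  fixes X :: "'a topology"
  assumes compact: "compact_space X" and Hausdorff: "Hausdorff_space X"
begin

lemma separating_function:
  assumes "closedin X C" "x \<in> topspace X" "x \<notin> C"
  obtains g where "continuous_map X euclideanreal g" "g x = 0" "\<And>y. y \<in> C \<Longrightarrow> g y = 1"
proof -
  have "completely_regular_space X"
    using compact Hausdorff
    by (intro normal_imp_completely_regular_space compact_Hausdorff_or_regular_imp_normal_space) auto
  then obtain g where g: "continuous_map X euclideanreal g" "g x = 0" and "g ` C \<subseteq> {1}"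
    using assms unfolding completely_regular_space_alt by blast
  then have "\<And>y. y \<in> C \<Longrightarrow> g y = 1"
    by blast
  with g show thesis
    using that by blast
qed

text \<open>\<open>K\<close> stands apart so that limits can be sought inside a prescribed closed
  set; the case \<open>J = {}\<close> already asks for a point of \<open>K\<close>.\<close>

lemma common_point:
  assumes K: "closedin X K" and C: "\<And>i. i \<in> I \<Longrightarrow> closedin X (C i)"
    and fin: "\<And>J. finite J \<Longrightarrow> J \<subseteq> I \<Longrightarrow> \<exists>x\<in>K. \<forall>i\<in>J. x \<in> C i"
  obtains x where "x \<in> K" "\<And>i. i \<in> I \<Longrightarrow> x \<in> C i"
proof -
  have "\<Inter>(insert K (C ` I)) \<noteq> {}"
  proof (rule compact[unfolded compact_space_fip, rule_format], intro conjI ballI allI impI)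
    fix F assume F: "finite F \<and> F \<subseteq> insert K (C ` I)"
    then have "finite (F - {K})" "F - {K} \<subseteq> C ` I"
      by auto
    then obtain J where J: "J \<subseteq> I" "finite J" "F - {K} = C ` J"
      by (meson finite_subset_image)
    then obtain x where "x \<in> K" "\<forall>i\<in>J. x \<in> C i"
      using fin by blast
    then have "\<forall>S\<in>F. x \<in> S"
      using J(3) by blast
    then show "\<Inter>F \<noteq> {}"
      by blast
  qed (use K C in auto)
  then show thesis
    using that by auto
qed

text \<open>Pseudocharacter controls character in a compactum: if no finite set of conditions
  \<open>\<bar>g x\<bar> < 1 / (n + 1)\<close> forced \<open>x\<close> into \<open>U\<close>,
  compactness would give a common zero of \<open>G\<close> outside \<open>U\<close>.\<close>

lemma local_base_of_zeros:
  assumes r: "Card_order r" "infinite (Field r)" and G: "|G| \<le>o r"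
    and cont: "\<And>g. g \<in> G \<Longrightarrow> continuous_map X euclideanreal g"
    and p: "zeros X G = {p}"
  obtains B where "local_base X p B" "|B| \<le>o r"
proof -
  define V where "V = (\<lambda>(a, n :: nat). {x \<in> topspace X. \<forall>g\<in>a. \<bar>g x\<bar> < 1 / (real n + 1)})"
  define I where "I = {a. finite a \<and> a \<subseteq> G} \<times> (UNIV :: nat set)"
  have pX: "p \<in> topspace X" "\<And>g. g \<in> G \<Longrightarrow> g p = 0"
    using p by (auto simp: zeros_def)
  have V: "openin X (V i)" "p \<in> V i" if i: "i \<in> I" for i
  proof -
    obtain a n where a: "i = (a, n)" "finite a" "\<And>g. g \<in> a \<Longrightarrow> g \<in> G"
      using i by (auto simp: I_def)
    then show "openin X (V i)"
      using cont by (auto simp: V_def intro!: openin_finite_Ball openin_abs_less)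
    have "\<bar>g p\<bar> < 1 / (real n + 1)" if "g \<in> a" for g
      using pX(2)[OF a(3)[OF that]] by simp
    then show "p \<in> V i"
      using a(1) pX(1) by (simp add: V_def)
  qed
  show thesis
  proof (rule that)
    have "|V ` I| \<le>o |I|"
      by (rule card_of_image)
    also have "|I| \<le>o r"
      unfolding I_def using r
      by (intro card_of_Times_ordLeq_infinite_Field card_of_finite_subsets[OF r G] card_of_nat_ordLeq)
    finally show "|V ` I| \<le>o r" .
    show "local_base X p (V ` I)"
      unfolding local_base_def
    proof (intro conjI ballI)
      show "V ` I \<subseteq> nbhds X p"
        using V by (auto simp: nbhds_def interior_of_openin dest: openin_subset)
      fix N assume N: "N \<in> nbhds X p"
      define U where "U = X interior_of N"
      have U: "openin X U" "p \<in> U" "U \<subseteq> N"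
        using N by (auto simp: U_def nbhds_def interior_of_subset)
      show "\<exists>W\<in>V ` I. W \<subseteq> N"
      proof (rule ccontr)
        assume "\<not> (\<exists>W\<in>V ` I. W \<subseteq> N)"
        then have neg: "\<not> V i \<subseteq> U" if "i \<in> I" for i
          using U that by blast
        define C where "C = (\<lambda>(g :: 'a \<Rightarrow> real, n :: nat). {x \<in> topspace X. \<bar>g x\<bar> \<le> 1 / (real n + 1)})"
        obtain x where x: "x \<in> topspace X - U" "\<And>i. i \<in> G \<times> UNIV \<Longrightarrow> x \<in> C i"
        proof (rule common_point[of "topspace X - U" "G \<times> UNIV" C])
          show "closedin X (topspace X - U)"
            using U by auto
          show "closedin X (C i)" if "i \<in> G \<times> UNIV" for i
            using that cont by (auto simp: C_def intro: closedin_abs_le)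
          fix J :: "(('a \<Rightarrow> real) \<times> nat) set" assume J: "finite J" "J \<subseteq> G \<times> UNIV"
          \<comment> \<open>An upper bound for the indices in \<open>J\<close> gives the smallest
            radius, so a single member of the base serves all pairs in \<open>J\<close>.\<close>
          obtain n where n: "\<And>m. m \<in> snd ` J \<Longrightarrow> m \<le> n"
            using J by (metis finite_imageI finite_nat_set_iff_bounded_le)
          have "(fst ` J, n) \<in> I"
            using J by (auto simp: I_def)
          then obtain x where x: "x \<in> V (fst ` J, n)" "x \<notin> U"
            using neg by blast
          have "\<bar>g x\<bar> \<le> 1 / (real m + 1)" if "(g, m) \<in> J" for g m
          proof -
            have "\<bar>g x\<bar> < 1 / (real n + 1)"
              using x that by (force simp: V_def)
            also have "\<dots> \<le> 1 / (real m + 1)"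
              using n[of m] that by (force simp: frac_le)
            finally show ?thesis by simp
          qed
          then show "\<exists>x\<in>topspace X - U. \<forall>i\<in>J. x \<in> C i"
            using x by (intro bexI[of _ x]) (auto simp: C_def V_def)
        qed blast
        have "g x = 0" if "g \<in> G" for g
        proof (rule ccontr)
          assume "g x \<noteq> 0"
          then obtain n where "inverse (real (Suc n)) < \<bar>g x\<bar>"
            using reals_Archimedean[of "\<bar>g x\<bar>"] by auto
          moreover have "\<bar>g x\<bar> \<le> 1 / (real n + 1)"
            using x(2)[of "(g, n)"] that by (simp add: C_def)
          ultimately show False
            by (simp add: inverse_eq_divide add.commute)
        qed
        then have "x \<in> zeros X G"
          using x by (auto simp: zeros_def)
        then show False
          using p x U by auto
      qed
    qed
  qed
qed

text \<open>
  Shapirovskii: the functions are chosen so that the sets \<open>S g a b\<close>, which are too few to form a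
  local \<open>\<pi>\<close>-base at \<open>p\<close>, all leave the neighbourhood of \<open>p\<close> on which the next function is small.
\<close>

lemma free_sequence_of_pi_character:
  assumes r: "Card_order r" "infinite (Field r)" and p: "p \<in> topspace X"
    and pi: "\<And>P. local_pi_base X p P \<Longrightarrow> \<not> |P| <o r"
  shows "\<exists>x. free_sequence X r x"
proof -
  have wo: "Well_order r"
    using r by (simp add: card_order_on_def)
  define S where "S g a b = {x \<in> topspace X. (\<forall>j\<in>a. g j x < 1/3) \<and> (\<forall>j\<in>b. g j x > 2/3)}"
    for g :: "'b \<Rightarrow> 'a \<Rightarrow> real" and a b
  \<comment> \<open>Vanishing at \<open>p\<close> makes all upper bounds compatible; the last clause
    allows one more lower bound to be added to any consistent finite set of earlier bounds.\<close>
  define good where "good g i h \<longleftrightarrow> continuous_map X euclideanreal h \<and> h p = 0 \<and>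
      (\<forall>a b. finite a \<and> finite b \<and> a \<subseteq> underS r i \<and> b \<subseteq> underS r i \<and> S g a b \<noteq> {} \<longrightarrow>
         (\<exists>x\<in>S g a b. h x > 2/3))" for g i and h :: "'a \<Rightarrow> real"
  have Scong: "S f a b = S g a b" if "\<And>j. j \<in> underS r i \<Longrightarrow> f j = g j" "a \<subseteq> underS r i" "b \<subseteq> underS r i"
    for f g a b i
  proof -
    have "\<And>j. j \<in> a \<Longrightarrow> f j = g j" "\<And>j. j \<in> b \<Longrightarrow> f j = g j"
      using that by auto
    then show ?thesis by (simp add: S_def)
  qed
  have openS: "openin X (S g a b)"
    if "finite a" "finite b" "\<And>j. j \<in> a \<union> b \<Longrightarrow> continuous_map X euclideanreal (g j)" for g a b
  proof -
    have "openin X ({x \<in> topspace X. \<forall>j\<in>a. g j x < 1/3} \<inter> {x \<in> topspace X. \<forall>j\<in>b. g j x > 2/3})"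
      using that by (intro openin_Int openin_finite_Ball openin_less openin_greater) auto
    also have "\<dots> = S g a b"
      by (auto simp: S_def)
    finally show ?thesis .
  qed
  obtain g where g: "\<And>i. i \<in> Field r \<Longrightarrow> good g i (g i)"
  proof (rule transfinite_choice[OF wo, of good])
    fix f g :: "'b \<Rightarrow> 'a \<Rightarrow> real" and i h assume "\<And>j. j \<in> underS r i \<Longrightarrow> f j = g j"
    then have "\<And>a b. a \<subseteq> underS r i \<Longrightarrow> b \<subseteq> underS r i \<Longrightarrow> S f a b = S g a b"
      by (rule Scong)
    then show "good f i h = good g i h"
      unfolding good_def by (intro conj_cong refl iff_allI) (metis (no_types, lifting))
  next
    fix g i assume i: "i \<in> Field r" and IH: "\<And>j. j \<in> underS r i \<Longrightarrow> good g j (g j)"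
    define E where "E = {a. finite a \<and> a \<subseteq> underS r i}"
    define P where "P = (\<lambda>(a, b). S g a b) ` (E \<times> E) - {{}}"
    have "|E| <o r"
      unfolding E_def by (intro card_of_finite_subsets_ordLess r card_of_underS i)
    then have "|E \<times> E| <o r"
      using r by (intro card_of_Times_ordLess_infinite)
    moreover have "|P| \<le>o |E \<times> E|"
      unfolding P_def by (rule surj_imp_ordLeq[of _ "\<lambda>(a, b). S g a b"]) auto
    ultimately have "|P| <o r"
      using ordLeq_ordLess_trans by blast
    then have "\<not> local_pi_base X p P"
      using pi by blast
    moreover have "openin X V \<and> V \<noteq> {}" if V: "V \<in> P" for V
    proof -
      obtain a b where "a \<in> E" "b \<in> E" "V = S g a b" "V \<noteq> {}"
        using V by (auto simp: P_def)
      then show ?thesis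
        using IH openS[of a b g] by (auto simp: E_def good_def)
    qed
    ultimately obtain N where N: "openin X N" "p \<in> N" "\<And>V. V \<in> P \<Longrightarrow> \<not> V \<subseteq> N"
      by (auto simp: local_pi_base_def)
    obtain h where h: "continuous_map X euclideanreal h" "h p = 0"
      "\<And>y. y \<in> topspace X - N \<Longrightarrow> h y = 1"
      using separating_function[of "topspace X - N" p] N p by blast
    have "\<exists>x\<in>S g a b. h x > 2/3"
      if ab: "finite a" "finite b" "a \<subseteq> underS r i" "b \<subseteq> underS r i" "S g a b \<noteq> {}" for a b
    proof -
      have "S g a b \<in> P"
        using ab by (auto simp: P_def E_def)
      then obtain x where x: "x \<in> S g a b" "x \<notin> N"
        using N(3) by blast
      then have "h x = 1"
        using h(3) by (auto simp: S_def)
      then show ?thesis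
        using x by (intro bexI[of _ x]) auto
    qed
    then have "good g i h"
      unfolding good_def using h by auto
    then show "\<exists>h. good g i h"
      by blast
  qed blast
  have cont: "continuous_map X euclideanreal (g i)" "g i p = 0" if "i \<in> Field r" for i
    using g[OF that] by (auto simp: good_def)
  \<comment> \<open>\<open>p\<close> satisfies the upper bounds in \<open>a\<close>. The lower
    bounds in \<open>b\<close> are then added in increasing order of index, each by
    \<open>good\<close>, which is why \<open>a\<close> has to precede \<open>b\<close>.\<close>
  have nonempty: "S g a b \<noteq> {}"
    if "finite b" "finite a" "a \<subseteq> Field r" "b \<subseteq> Field r" "\<And>i j. i \<in> a \<Longrightarrow> j \<in> b \<Longrightarrow> i \<in> underS r j" for a b
    using that
  proof (induction "card b" arbitrary: b)
    case 0
    then have "p \<in> S g a b"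
      using p cont by (auto simp: S_def)
    then show ?case by blast
  next
    case (Suc n)
    have bne: "b \<noteq> {}" using Suc.hyps(2) by auto
    obtain k where k: "k \<in> b" "\<And>j. j \<in> b \<Longrightarrow> (j, k) \<in> r"
      using finite_has_greatest[OF wo Suc.prems(1) bne Suc.prems(4)] by blast
    have "S g a (b - {k}) \<noteq> {}"
      using Suc.prems Suc.hyps(2) k(1) by (intro Suc.hyps(1)) auto
    moreover have "a \<subseteq> underS r k" "k \<in> Field r"
      using k(1) Suc.prems(4,5) by blast+
    moreover have "b - {k} \<subseteq> underS r k"
      using k(2) by (auto simp: underS_def)
    ultimately obtain x where "x \<in> S g a (b - {k})" "g k x > 2/3"
      using g[of k, unfolded good_def, THEN conjunct2, THEN conjunct2, rule_format, of a "b - {k}"]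
        Suc.prems(1,2) by auto
    then have "x \<in> S g a b"
      by (auto simp: S_def)
    then show ?case by blast
  qed
  \<comment> \<open>A cut at \<open>k\<close>: indices up to and including \<open>k\<close> impose
    upper bounds, later ones lower bounds. So \<open>g i\<close> is large at the points before
    \<open>i\<close> and small from \<open>i\<close> on.\<close>
  define near where "near k x \<longleftrightarrow> x \<in> topspace X \<and>
      (\<forall>i\<in>Field r. if (i, k) \<in> r then g i x \<le> 1/3 else g i x \<ge> 2/3)" for k x
  have "\<forall>k\<in>Field r. \<exists>x. near k x"
  proof
    fix k assume k: "k \<in> Field r"
    define C where "C i = (if (i, k) \<in> r then {x \<in> topspace X. g i x \<le> 1/3} else {x \<in> topspace X. g i x \<ge> 2/3})" for i
    obtain x where x: "x \<in> topspace X" "\<And>i. i \<in> Field r \<Longrightarrow> x \<in> C i"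
    proof (rule common_point[of "topspace X" "Field r" C])
      show "closedin X (C i)" if "i \<in> Field r" for i
        by (cases "(i, k) \<in> r") (simp_all only: C_def if_True if_False
            closedin_le[OF cont(1)[OF that]] closedin_ge[OF cont(1)[OF that]])
      fix J assume J: "finite J" "J \<subseteq> Field r"
      define a b where "a = {i \<in> J. (i, k) \<in> r}" and "b = {i \<in> J. (i, k) \<notin> r}"
      have "i \<in> underS r j" if ij: "i \<in> a" "j \<in> b" for i j
      proof -
        have "trans r"
          using wo unfolding order_on_defs by auto
        moreover have *: "i \<in> Field r" "j \<in> Field r" "(i, k) \<in> r" "(j, k) \<notin> r"
          using ij J by (auto simp: a_def b_def)
        ultimately have "(j, i) \<notin> r"
          by (meson transD)
        then show ?thesis
          using Well_order_cases[OF wo *(2,1)] by blast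
      qed
      then have "S g a b \<noteq> {}"
        using J by (intro nonempty) (auto simp: a_def b_def)
      then obtain x where x: "x \<in> S g a b"
        by blast
      have "x \<in> C i" if "i \<in> J" for i
        using x that by (force simp: S_def C_def a_def b_def)
      then show "\<exists>x\<in>topspace X. \<forall>i\<in>J. x \<in> C i"
        using x by (auto simp: S_def)
    qed auto
    have "if (i, k) \<in> r then g i x \<le> 1/3 else g i x \<ge> 2/3" if "i \<in> Field r" for i
      using x(2)[OF that] by (simp add: C_def split: if_splits)
    then show "\<exists>x. near k x"
      unfolding near_def using x(1) by blast
  qed
  from bchoice[OF this] obtain x where nx: "\<forall>k\<in>Field r. near k (x k)" ..
  have x: "x k \<in> topspace X" if "k \<in> Field r" for k
    using bspec[OF nx that] by (simp add: near_def)
  have gx: "if (i, k) \<in> r then g i (x k) \<le> 1/3 else g i (x k) \<ge> 2/3" if "i \<in> Field r" "k \<in> Field r" for i k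
    using bspec[OF nx that(2), unfolded near_def, THEN conjunct2, THEN bspec, OF that(1)] .
  have "free_sequence X r x"
  proof (rule free_sequenceI[OF wo x cont(1)])
    fix i j assume i: "i \<in> Field r" and j: "j \<in> underS r i"
    then have jF: "j \<in> Field r"
      by (auto simp: underS_def Field_def)
    then have "(i, j) \<notin> r"
      using j Well_order_cases[OF wo i, of j] by blast
    then show "g i (x j) \<ge> 2/3"
      using gx[OF i jF] by simp
  next
    fix i j assume ij: "(i, j) \<in> r"
    then have "i \<in> Field r" "j \<in> Field r"
      by (auto simp: Field_def)
    then show "g i (x j) \<le> 1/3"
      using gx[of i j] ij by simp
  qed
  then show ?thesis
    by blast
qed

text \<open>Finitely many indices have a greatest one, and the point given for it by
  \<open>below\<close> is a zero of all their functions; compactness does the rest. It serves with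
  \<open>U\<close> an initial segment during a recursion and with \<open>U\<close> the whole field
  at its end.\<close>

lemma zeros_nonempty:
  assumes r: "Well_order r" and U: "U \<subseteq> Field r"
    and cont: "\<And>i. i \<in> U \<Longrightarrow> continuous_map X euclideanreal (g i)"
    and ne: "topspace X \<noteq> {}"
    and below: "\<And>k. k \<in> U \<Longrightarrow> \<exists>z\<in>topspace X. \<forall>j. (j, k) \<in> r \<longrightarrow> g j z = 0"
  shows "zeros X (g ` U) \<noteq> {}"
proof -
  obtain z where z: "z \<in> topspace X" "\<And>i. i \<in> U \<Longrightarrow> z \<in> {x \<in> topspace X. g i x = 0}"
  proof (rule common_point[of "topspace X" U "\<lambda>i. {x \<in> topspace X. g i x = 0}"])
    fix J assume J: "finite J" "J \<subseteq> U"
    show "\<exists>z\<in>topspace X. \<forall>i\<in>J. z \<in> {x \<in> topspace X. g i x = 0}"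
    proof (cases "J = {}")
      case True
      then show ?thesis using ne by blast
    next
      case False
      have JF: "J \<subseteq> Field r" using J U by blast
      obtain k where k: "k \<in> J" "\<And>j. j \<in> J \<Longrightarrow> (j, k) \<in> r"
        using finite_has_greatest[OF r J(1) False JF] by blast
      obtain z where "z \<in> topspace X" "\<forall>j. (j, k) \<in> r \<longrightarrow> g j z = 0"
        using below[of k] k(1) J(2) by blast
      then show ?thesis
        using k(2) by (intro bexI[of _ z]) auto
    qed
  qed (auto intro: closedin_eq cont)
  then have "z \<in> zeros X (g ` U)"
    by (auto simp: zeros_def)
  then show ?thesis by blast
qed

text \<open>Otherwise one can always choose, among the common zeros of the earlier functions, a
  point outside the closure of the earlier points, together with a function that is 0 there and 1 at
  the earlier points. This would give a free sequence of length \<open>r\<close>.\<close>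

lemma small_zeros_in_small_closure:
  assumes r: "Card_order r" "infinite (Field r)" and ne: "topspace X \<noteq> {}"
    and nofree: "\<not> (\<exists>x. free_sequence X r x)"
  obtains G A where "\<And>g. g \<in> G \<Longrightarrow> continuous_map X euclideanreal g" "|G| <o r"
    "A \<subseteq> topspace X" "|A| <o r" "zeros X G \<noteq> {}" "zeros X G \<subseteq> X closure_of A"
proof (rule ccontr)
  note witness = that
  assume nt: "\<not> thesis"
  have neg: "\<not> zeros X G \<subseteq> X closure_of A"
    if G: "\<And>g. g \<in> G \<Longrightarrow> continuous_map X euclideanreal g" "|G| <o r"
      and A: "A \<subseteq> topspace X" "|A| <o r" and ne: "zeros X G \<noteq> {}" for G A
    using witness[OF G A ne] nt by blast
  have wo: "Well_order r"
    using r by (simp add: card_order_on_def)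
  define good where "good f i y \<longleftrightarrow> fst y \<in> topspace X \<and> continuous_map X euclideanreal (snd y) \<and>
      snd y (fst y) = 0 \<and> (\<forall>j\<in>underS r i. snd (f j) (fst y) = 0 \<and> snd y (fst (f j)) = 1)"
    for f :: "'b \<Rightarrow> 'a \<times> ('a \<Rightarrow> real)" and i y
  obtain f where f: "\<And>i. i \<in> Field r \<Longrightarrow> good f i (f i)"
  proof (rule transfinite_choice[OF wo, of good])
    fix f g :: "'b \<Rightarrow> 'a \<times> ('a \<Rightarrow> real)" and i y assume "\<And>j. j \<in> underS r i \<Longrightarrow> f j = g j"
    then show "good f i y = good g i y"
      by (simp add: good_def)
  next
    fix f i assume i: "i \<in> Field r" and IH: "\<And>j. j \<in> underS r i \<Longrightarrow> good f j (f j)"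
    have UF: "underS r i \<subseteq> Field r"
      by (auto simp: underS_def Field_def)
    define G where "G = (\<lambda>j. snd (f j)) ` underS r i"
    define A where "A = (\<lambda>j. fst (f j)) ` underS r i"
    have small: "|G| <o r" "|A| <o r"
      unfolding G_def A_def using card_of_underS[OF r(1) i] card_of_image ordLeq_ordLess_trans by blast+
    have contG: "continuous_map X euclideanreal g" if "g \<in> G" for g
      using IH that by (auto simp: G_def good_def)
    have AX: "A \<subseteq> topspace X"
      using IH by (auto simp: A_def good_def)
    have "zeros X G \<noteq> {}"
      unfolding G_def
    proof (rule zeros_nonempty[OF wo UF _ ne])
      fix k assume k: "k \<in> underS r i"
      have "snd (f j) (fst (f k)) = 0" if "(j, k) \<in> r" for j
        using IH[OF k] that by (cases "j = k") (auto simp: good_def underS_def)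
      then show "\<exists>z\<in>topspace X. \<forall>j. (j, k) \<in> r \<longrightarrow> snd (f j) z = 0"
        using IH[OF k] by (intro bexI[of _ "fst (f k)"]) (auto simp: good_def)
    qed (use contG in \<open>auto simp: G_def\<close>)
    then obtain x where x: "x \<in> zeros X G" "x \<notin> X closure_of A"
      using neg[OF contG small(1) AX small(2)] by blast
    then have xX: "x \<in> topspace X" by (simp add: zeros_def)
    obtain g where g: "continuous_map X euclideanreal g" "g x = 0" "\<And>y. y \<in> X closure_of A \<Longrightarrow> g y = 1"
      using separating_function[OF closedin_closure_of xX x(2)] by blast
    have "A \<subseteq> X closure_of A"
      using AX by (rule closure_of_subset)
    then have "good f i (x, g)"
      using g xX x(1) by (auto simp: good_def zeros_def G_def A_def)
    then show "\<exists>y. good f i y" by blast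
  qed blast
  have "free_sequence X r (\<lambda>i. fst (f i))"
  proof (rule free_sequenceI[OF wo, where g = "\<lambda>i. snd (f i)"])
    fix i j assume "i \<in> Field r" "j \<in> underS r i"
    then show "2 / 3 \<le> snd (f i) (fst (f j))"
      using f[of i] by (simp add: good_def)
  next
    fix i j assume ij: "(i, j) \<in> r"
    then have "good f j (f j)"
      using f by (auto simp: Field_def)
    then show "snd (f i) (fst (f j)) \<le> 1 / 3"
      using ij by (cases "i = j") (auto simp: good_def underS_def)
  qed (use f in \<open>auto simp: good_def\<close>)
  then show False
    using nofree by blast
qed

text \<open>
  Arhangelskii's free sequence argument: otherwise a point of the closure outside \<open>Y\<close> is separated
  from each initial segment of a sequence in \<open>Y\<close> by functions vanishing at that point.
\<close>

lemma closedin_if_small_closures: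
  assumes r: "Card_order r" "infinite (Field r)"
    and nofree: "\<not> (\<exists>x. free_sequence X r x)"
    and Y: "Y \<subseteq> topspace X" and cl: "\<And>A. A \<subseteq> Y \<Longrightarrow> |A| <o r \<Longrightarrow> X closure_of A \<subseteq> Y"
  shows "closedin X Y"
proof (rule ccontr)
  assume "\<not> closedin X Y"
  then obtain q where q: "q \<in> X closure_of Y" "q \<notin> Y"
    using Y closure_of_subset_eq[of Y X] by blast
  then have qX: "q \<in> topspace X"
    by (simp add: in_closure_of)
  have wo: "Well_order r"
    using r by (simp add: card_order_on_def)
  define good where "good f i y \<longleftrightarrow> fst y \<in> Y \<and> continuous_map X euclideanreal (snd y) \<and>
      snd y q = 0 \<and> snd y (fst y) \<le> 1/3 \<and>
      (\<forall>j\<in>underS r i. snd (f j) (fst y) \<le> 1/3 \<and> snd y (fst (f j)) = 1)"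
    for f :: "'b \<Rightarrow> 'a \<times> ('a \<Rightarrow> real)" and i y
  obtain f where f: "\<And>i. i \<in> Field r \<Longrightarrow> good f i (f i)"
  proof (rule transfinite_choice[OF wo, of good])
    fix f g :: "'b \<Rightarrow> 'a \<times> ('a \<Rightarrow> real)" and i y assume "\<And>j. j \<in> underS r i \<Longrightarrow> f j = g j"
    then show "good f i y = good g i y"
      by (simp add: good_def)
  next
    fix f i assume i: "i \<in> Field r" and IH: "\<And>j. j \<in> underS r i \<Longrightarrow> good f j (f j)"
    define A where "A = (\<lambda>j. fst (f j)) ` underS r i"
    have small: "|underS r i| <o r"
      by (rule card_of_underS[OF r(1) i])
    then have "|A| <o r"
      unfolding A_def using card_of_image ordLeq_ordLess_trans by blast
    moreover have AY: "A \<subseteq> Y"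
      using IH by (auto simp: A_def good_def)
    ultimately have "q \<notin> X closure_of A"
      using cl q(2) by blast
    then obtain g where g: "continuous_map X euclideanreal g" "g q = 0" "\<And>y. y \<in> X closure_of A \<Longrightarrow> g y = 1"
      using separating_function[OF closedin_closure_of qX] by blast
    have AcA: "A \<subseteq> X closure_of A"
      using AY Y by (intro closure_of_subset) auto
    \<comment> \<open>\<open>g\<close> is included because the final segment that starts at
      \<open>i\<close> contains \<open>i\<close> itself.\<close>
    define K where "K = insert g ((\<lambda>j. snd (f j)) ` underS r i)"
    have K: "continuous_map X euclideanreal h" "h q = 0" if "h \<in> K" for h
      using that g(1,2) IH by (auto simp: K_def good_def)
    have "|{g}| <o r" "|(\<lambda>j. snd (f j)) ` underS r i| <o r"
      using card_of_finite_ordLess[OF r] ordLeq_ordLess_trans[OF card_of_image small] by auto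
    then have "|{g} \<union> (\<lambda>j. snd (f j)) ` underS r i| <o r"
      using r by (intro card_of_Un_ordLess_infinite_Field)
    then have smallK: "|K| <o r"
      by (simp add: K_def)
    define E where "E = {J. finite J \<and> J \<subseteq> K}"
    \<comment> \<open>\<open>q\<close> meets all conditions but lies outside \<open>Y\<close>. Fewer
      than \<open>r\<close> points of \<open>Y\<close> suffice to meet the finite sets of
      conditions; their closure stays in \<open>Y\<close>, and compactness finds there a point
      meeting all of them, with weak inequalities.\<close>
    have "\<forall>J\<in>E. \<exists>y. y \<in> Y \<and> (\<forall>h\<in>J. h y < 1/3)"
    proof
      fix J assume J: "J \<in> E"
      define W where "W = {x \<in> topspace X. \<forall>h\<in>J. h x < 1/3}"
      have W: "openin X W"
        unfolding W_def using J K(1) by (intro openin_finite_Ball openin_less) (auto simp: E_def)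
      have "h q < 1/3" if "h \<in> J" for h
        using J K(2)[of h] that by (auto simp: E_def)
      then have "q \<in> W"
        using qX by (simp add: W_def)
      then obtain y where y: "y \<in> Y" "y \<in> W"
        using q(1) W unfolding in_closure_of by blast
      then have "\<forall>h\<in>J. h y < 1/3"
        by (simp add: W_def)
      with y(1)show "\<exists>y. y \<in> Y \<and> (\<forall>h\<in>J. h y < 1/3)"
        by blast
    qed
    from bchoice[OF this] obtain y where y: "\<And>J. J \<in> E \<Longrightarrow> y J \<in> Y" "\<And>J h. J \<in> E \<Longrightarrow> h \<in> J \<Longrightarrow> h (y J) < 1/3"
      by blast
    have "|y ` E| <o r"
      using card_of_finite_subsets_ordLess[OF r smallK] card_of_image ordLeq_ordLess_trans
      unfolding E_def by blast
    moreover have yY: "y ` E \<subseteq> Y"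
      using y(1) by blast
    ultimately have clY: "X closure_of (y ` E) \<subseteq> Y"
      using cl by blast
    obtain x where x: "x \<in> X closure_of (y ` E)" "\<And>h. h \<in> K \<Longrightarrow> x \<in> {x \<in> topspace X. h x \<le> 1/3}"
    proof (rule common_point[of "X closure_of (y ` E)" K "\<lambda>h. {x \<in> topspace X. h x \<le> 1/3}"])
      fix J assume "finite J" "J \<subseteq> K"
      then have J: "J \<in> E" by (simp add: E_def)
      have "y J \<in> X closure_of (y ` E)"
        using closure_of_subset[of "y ` E" X] yY Y J by blast
      moreover have "y J \<in> topspace X"
        using y(1) J Y by blast
      ultimately show "\<exists>x\<in>X closure_of (y ` E). \<forall>h\<in>J. x \<in> {x \<in> topspace X. h x \<le> 1/3}"
        using y(2)[OF J] by (intro bexI[of _ "y J"]) (auto intro: less_imp_le)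
    qed (simp_all only: closedin_closure_of closedin_le K(1))
    have "x \<in> Y"
      using x(1) clY by blast
    moreover have "h x \<le> 1/3" if "h \<in> K" for h
      using x(2)[OF that] by blast
    ultimately have "good f i (x, g)"
      using g AcA by (auto simp: good_def A_def K_def)
    then show "\<exists>y. good f i y" by blast
  qed blast
  have "free_sequence X r (\<lambda>i. fst (f i))"
  proof (rule free_sequenceI[OF wo, where g = "\<lambda>i. snd (f i)"])
    fix i j assume "i \<in> Field r" "j \<in> underS r i"
    then show "2 / 3 \<le> snd (f i) (fst (f j))"
      using f[of i] by (simp add: good_def)
  next
    fix i j assume ij: "(i, j) \<in> r"
    then have "good f j (f j)"
      using f by (auto simp: Field_def)
    then show "snd (f i) (fst (f j)) \<le> 1 / 3"
      using ij by (cases "i = j") (auto simp: good_def underS_def)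
  qed (use f Y in \<open>auto simp: good_def\<close>)
  then show False
    using nofree by blast
qed

text \<open>
  A diagonal form of the Cech-Pospisil argument: if all characters were at least \<open>r\<close>, a decreasing
  sequence of zero sets could exclude the points one at a time, since an intersection of fewer than
  \<open>r\<close> zero sets would never be a single point.
\<close>

lemma cech_pospisil:
  assumes r: "Card_order r" and unc: "|UNIV :: nat set| <o r"
    and ne: "topspace X \<noteq> {}" and card: "|topspace X| \<le>o r"
  obtains p B where "p \<in> topspace X" "local_base X p B" "|B| <o r"
proof (rule ccontr)
  note witness = that
  assume nt: "\<not> thesis"
  \<comment> \<open>The points of \<open>X\<close> are themselves the indices, and the function with
    index \<open>x\<close> must not vanish at \<open>x\<close>.\<close>
  define s where "s = |topspace X|"
  have s: "Card_order s" "Field s = topspace X" "s \<le>o r"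
    using card by (simp_all add: s_def)
  have wo: "Well_order s"
    using s(1) by (simp add: card_order_on_def)
  have infr: "infinite (Field r)"
    using unc r by (metis card_of_Field_ordIso finite_iff_ordLess_natLeq infinite_UNIV_nat
        infinite_iff_card_of_nat ordIso_ordLess_trans ordLess_imp_ordLeq ordLess_ordIso_trans
        ordIso_symmetric)
  define good where "good f x g \<longleftrightarrow> continuous_map X euclideanreal g \<and> g x \<noteq> 0 \<and>
      (\<exists>z\<in>topspace X. g z = 0 \<and> (\<forall>y\<in>underS s x. f y z = 0))"
    for f :: "'a \<Rightarrow> 'a \<Rightarrow> real" and x g
  obtain f where f: "\<And>x. x \<in> Field s \<Longrightarrow> good f x (f x)"
  proof (rule transfinite_choice[OF wo, of good])
    fix f g :: "'a \<Rightarrow> 'a \<Rightarrow> real" and x h assume "\<And>y. y \<in> underS s x \<Longrightarrow> f y = g y"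
    then show "good f x h = good g x h"
      by (simp add: good_def)
  next
    fix f x assume x: "x \<in> Field s" and IH: "\<And>y. y \<in> underS s x \<Longrightarrow> good f y (f y)"
    have UF: "underS s x \<subseteq> Field s"
      by (auto simp: underS_def Field_def)
    have xX: "x \<in> topspace X"
      using x s by simp
    have contf: "continuous_map X euclideanreal g" if "g \<in> f ` underS s x" for g
      using IH that by (auto simp: good_def)
    have nonempty: "zeros X (f ` underS s x) \<noteq> {}"
    proof (rule zeros_nonempty[OF wo UF _ ne])
      fix k assume k: "k \<in> underS s x"
      then obtain z where z: "z \<in> topspace X" "f k z = 0" "\<forall>y\<in>underS s k. f y z = 0"
        using IH[OF k] by (auto simp: good_def)
      then have "f j z = 0" if "(j, k) \<in> s" for j
        using that by (cases "j = k") (auto simp: underS_def)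
      then show "\<exists>z\<in>topspace X. \<forall>j. (j, k) \<in> s \<longrightarrow> f j z = 0"
        using z(1) by blast
    qed (use contf in auto)
    have "zeros X (f ` underS s x) \<noteq> {x}"
    proof
      assume eq: "zeros X (f ` underS s x) = {x}"
      \<comment> \<open>The summand \<open>UNIV\<close> makes \<open>c\<close> infinite even at
        finite stages; \<open>unc\<close> keeps it below \<open>r\<close>.\<close>
      define c where "c = |f ` underS s x <+> (UNIV :: nat set)|"
      have c: "Card_order c" "infinite (Field c)" "|f ` underS s x| \<le>o c"
        by (simp_all add: c_def card_of_Plus1)
      obtain B where B: "local_base X x B" "|B| \<le>o c"
        using local_base_of_zeros[OF c contf eq] by blast
      have "|f ` underS s x| <o r"
        using card_of_image card_of_underS[OF s(1) x] s(3) ordLeq_ordLess_trans ordLess_ordLeq_trans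
        by metis
      then have "c <o r"
        unfolding c_def using r infr unc by (intro card_of_Plus_ordLess_infinite_Field)
      then have "|B| <o r"
        using B(2) ordLeq_ordLess_trans by blast
      then show False
        using witness[OF xX B(1)] nt by blast
    qed
    then obtain z where z: "z \<in> zeros X (f ` underS s x)" "z \<noteq> x"
      using nonempty by blast
    have zX: "z \<in> topspace X"
      using z(1) by (simp add: zeros_def)
    obtain g where g: "continuous_map X euclideanreal g" "g z = 0" "\<And>y. y \<in> {x} \<Longrightarrow> g y = 1"
      using separating_function[OF closedin_Hausdorff_singleton[OF Hausdorff xX] zX] z(2) by blast
    then have "good f x g"
      using z(1) by (auto simp: good_def zeros_def)
    then show "\<exists>g. good f x g" by blast
  qed blast
  have "zeros X (f ` Field s) \<noteq> {}"
  proof (rule zeros_nonempty[OF wo subset_refl _ ne])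
    fix k assume k: "k \<in> Field s"
    then obtain z where z: "z \<in> topspace X" "f k z = 0" "\<forall>y\<in>underS s k. f y z = 0"
      using f[OF k] by (auto simp: good_def)
    then have "f j z = 0" if "(j, k) \<in> s" for j
      using that by (cases "j = k") (auto simp: underS_def)
    then show "\<exists>z\<in>topspace X. \<forall>j. (j, k) \<in> s \<longrightarrow> f j z = 0"
      using z(1) by blast
  qed (use f in \<open>auto simp: good_def\<close>)
  \<comment> \<open>A common zero is itself an index, and the function with that index excludes
    it.\<close>
  then obtain z where "z \<in> zeros X (f ` Field s)"
    by blast
  then have "z \<in> Field s" "f z z = 0"
    using s(2) by (auto simp: zeros_def)
  then show False
    using f by (auto simp: good_def)
qed

text \<open>
  A point \<open>y\<close> of the closure of \<open>A\<close> lies in the closure of \<open>A \<inter> W\<close> for each neighbourhood \<open>W\<close> of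
  \<open>y\<close>, so the functions separating \<open>x\<close> from the closures of subsets of \<open>A\<close> isolate \<open>x\<close>.
\<close>

lemma local_base_in_zeros:
  assumes M: "infinite M" and G: "\<And>g. g \<in> G \<Longrightarrow> continuous_map X euclideanreal g" "|G| \<le>o |M|"
    and A: "A \<subseteq> topspace X" "|A| \<le>o |M|" "zeros X G \<subseteq> X closure_of A" and x: "x \<in> zeros X G"
  obtains B where "local_base X x B" "|B| \<le>o |Pow M|"
proof -
  define E where "E = {B. B \<subseteq> A \<and> x \<notin> X closure_of B}"
  have xX: "x \<in> topspace X"
    using x by (simp add: zeros_def)
  have "\<forall>B\<in>E. \<exists>g. continuous_map X euclideanreal g \<and> g x = 0 \<and> (\<forall>y\<in>X closure_of B. g y = 1)"
  proof
    fix B assume "B \<in> E"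
    then have "x \<notin> X closure_of B" by (simp add: E_def)
    then obtain g where "continuous_map X euclideanreal g" "g x = 0" "\<And>y. y \<in> X closure_of B \<Longrightarrow> g y = 1"
      using separating_function[OF closedin_closure_of xX] by blast
    then show "\<exists>g. continuous_map X euclideanreal g \<and> g x = 0 \<and> (\<forall>y\<in>X closure_of B. g y = 1)"
      by blast
  qed
  from bchoice[OF this] obtain h where h: "\<forall>B\<in>E. continuous_map X euclideanreal (h B) \<and> h B x = 0 \<and>
      (\<forall>y\<in>X closure_of B. h B y = 1)" ..
  have "zeros X (G \<union> h ` E) = {x}"
  proof (rule subset_antisym; rule subsetI)
    fix y assume "y \<in> {x}"
    then show "y \<in> zeros X (G \<union> h ` E)"
      using x h by (auto simp: zeros_def)
  next
    fix y assume y: "y \<in> zeros X (G \<union> h ` E)"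
    then have yX: "y \<in> topspace X" and "y \<in> zeros X G" and hy: "\<And>B. B \<in> E \<Longrightarrow> h B y = 0"
      by (auto simp: zeros_def)
    then have yA: "y \<in> X closure_of A"
      using A by blast
    show "y \<in> {x}"
    proof (rule ccontr)
      assume "y \<notin> {x}"
      then obtain U V where UV: "openin X U" "openin X V" "x \<in> U" "y \<in> V" "U \<inter> V = {}"
        using Hausdorff xX yX unfolding Hausdorff_space_def disjnt_def by (metis singletonI)
      have "x \<notin> X closure_of (A \<inter> V)"
        using UV unfolding in_closure_of by blast
      then have E: "A \<inter> V \<in> E"
        by (auto simp: E_def)
      have "y \<in> X closure_of (A \<inter> V)"
        unfolding in_closure_of
      proof (intro conjI allI impI yX)
        fix T assume "y \<in> T \<and> openin X T"
        then have "y \<in> T \<inter> V" "openin X (T \<inter> V)"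
          using UV by auto
        then show "\<exists>z. z \<in> A \<inter> V \<and> z \<in> T"
          using yA unfolding in_closure_of by blast
      qed
      then have "h (A \<inter> V) y = 1"
        using h E by blast
      then show False
        using hy[OF E] by simp
    qed
  qed
  moreover have "|G \<union> h ` E| \<le>o |Pow M|"
  proof (rule card_of_Un_ordLeq_infinite_Field)
    show "|G| \<le>o |Pow M|"
      using G(2) card_of_Pow ordLeq_transitive ordLess_imp_ordLeq by metis
    have "|h ` E| \<le>o |Pow A|"
      by (rule ordLeq_transitive[OF card_of_image card_of_mono1]) (auto simp: E_def)
    then show "|h ` E| \<le>o |Pow M|"
      using card_of_Pow_mono[OF A(2)] ordLeq_transitive by blast
  qed (use M in \<open>auto simp: finite_Pow_iff\<close>)
  moreover have "continuous_map X euclideanreal g" if "g \<in> G \<union> h ` E" for g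
    using that G h by auto
  ultimately show thesis
    using local_base_of_zeros[of "|Pow M|" "G \<union> h ` E" x] M that by auto
qed

subsection \<open>Density and cardinality\<close>

text \<open>
  Pytkeev's covering argument, with a set \<open>D\<close> closed under \<open>\<mu>\<close>-ary operations in place of an
  elementary submodel. The code of \<open>z\<close> determines the trace of the set \<open>zeros X (g z ` M)\<close> on the
  closure of a small set, so \<open>2\<^sup>\<mu>\<close> many of these sets cover that closure.
\<close>

lemma small_dense_set:
  fixes g :: "'a \<Rightarrow> 'm \<Rightarrow> 'a \<Rightarrow> real" and A :: "'a \<Rightarrow> 'a set" and M :: "'m set"
  assumes M: "infinite M"
    and nofree: "\<not> (\<exists>x. free_sequence X (cardSuc |M| ) x)"
    and cont: "\<And>z m. z \<in> topspace X \<Longrightarrow> m \<in> M \<Longrightarrow> continuous_map X euclideanreal (g z m)"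
    and g0: "\<And>z m. z \<in> topspace X \<Longrightarrow> m \<in> M \<Longrightarrow> g z m z = 0"
    and A: "\<And>z. z \<in> topspace X \<Longrightarrow> A z \<subseteq> topspace X \<and> |A z| \<le>o |M|"
    and gA: "\<And>z. z \<in> topspace X \<Longrightarrow> zeros X (g z ` M) \<subseteq> X closure_of A z"
  obtains D where "D \<subseteq> topspace X" "|D| \<le>o |Pow M|" "X closure_of D = topspace X"
proof -
  define U where "U = (\<lambda>(z, m, n :: nat). {x \<in> topspace X. \<bar>g z m x\<bar> < 1 / (real n + 1)})"
  \<comment> \<open>The traces on \<open>B\<close> of the neighbourhoods \<open>U (z, m, n)\<close>
    of \<open>z\<close>. A code is a subset of \<open>M \<times> UNIV \<times> B\<close>, so at most
    \<open>2\<^sup>\<mu>\<close> codes occur for \<open>B\<close> of size at most \<mu>;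
    \<open>Z B\<close> contains one centre for each code that occurs.\<close>
  define code where "code B z = {(m, n :: nat, a). m \<in> M \<and> a \<in> B \<and> a \<in> U (z, m, n)}" for B z
  define rep where "rep B c = (SOME z. z \<in> X closure_of B \<and> code B z = c)" for B c
  define Z where "Z B = rep B ` code B ` (X closure_of B)" for B
  \<comment> \<open>Closing off under \<open>pick\<close> lets a failure of neighbourhoods to cover
    \<open>X\<close> be witnessed inside \<open>D\<close>.\<close>
  define pick where "pick Q = (SOME x. x \<in> topspace X - \<Union>(U ` Q))" for Q
  define W where "W B = {Q. Q \<subseteq> B \<times> M \<times> UNIV \<and> \<not> topspace X \<subseteq> \<Union>(U ` Q)}" for B :: "'a set"
  define \<Phi> where "\<Phi> B = Z B \<union> (\<Union>z\<in>B. A z) \<union> pick ` W B" for B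
  have PM: "Card_order |Pow M|" "infinite (Field |Pow M| )"
    using M by (auto simp: finite_Pow_iff)
  have MM: "Card_order |M|" "infinite (Field |M| )"
    using M by auto
  have MP: "|M| \<le>o |Pow M|"
    using card_of_Pow ordLess_imp_ordLeq by blast
  have natM: "|UNIV :: nat set| \<le>o |M|"
    using card_of_nat_ordLeq[OF MM] .
  have rep: "rep B (code B y) \<in> X closure_of B" "code B (rep B (code B y)) = code B y"
    if "y \<in> X closure_of B" for B y
    using that someI[of "\<lambda>z. z \<in> X closure_of B \<and> code B z = code B y" y] unfolding rep_def by auto
  have Zcl: "Z B \<subseteq> X closure_of B" for B
    using rep(1) by (auto simp: Z_def)
  have Zcover: "\<exists>z\<in>Z B. y \<in> zeros X (g z ` M)" if y: "y \<in> X closure_of B" for B y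
  proof -
    define z where "z = rep B (code B y)"
    have z: "z \<in> Z B" "z \<in> topspace X" "code B z = code B y"
      using rep[OF y] y closure_of_subset_topspace[of X B] by (auto simp: z_def Z_def)
    have yX: "y \<in> topspace X"
      using y closure_of_subset_topspace[of X B] by blast
    have "g z m y = 0" if m: "m \<in> M" for m
    proof (rule ccontr)
      assume "g z m y \<noteq> 0"
      then obtain n where n: "inverse (real (Suc n)) < \<bar>g z m y\<bar>"
        using reals_Archimedean[of "\<bar>g z m y\<bar>"] by auto
      \<comment> \<open>Near \<open>y\<close>, \<open>g z m\<close> exceeds
        \<open>1 / (n + 1)\<close> in absolute value while \<open>g y m\<close> stays below it. A
        point of \<open>B\<close> there would distinguish the codes of \<open>y\<close> and
        \<open>z\<close>, which agree.\<close>
      define T where "T = {x \<in> topspace X. 1 / (real n + 1) < \<bar>g z m x\<bar>} \<inter> U (y, m, n)"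
      have "openin X T"
        unfolding T_def U_def prod.case
        using cont[OF z(2) m] cont[OF yX m] by (intro openin_Int openin_abs_greater openin_abs_less)
      moreover have "y \<in> T"
        using n yX g0[OF yX m] by (simp add: T_def U_def inverse_eq_divide add.commute)
      ultimately obtain a where a: "a \<in> B" "a \<in> T"
        using y unfolding in_closure_of by blast
      then have "(m, n, a) \<in> code B y"
        using m by (simp add: code_def T_def)
      then have "(m, n, a) \<in> code B z"
        using z(3) by simp
      then have "\<bar>g z m a\<bar> < 1 / (real n + 1)"
        by (simp add: code_def U_def)
      moreover have "1 / (real n + 1) < \<bar>g z m a\<bar>"
        using a(2) by (simp add: T_def)
      ultimately show False
        by linarith
    qed
    then have "y \<in> zeros X (g z ` M)"
      using yX by (simp add: zeros_def)
    then show ?thesis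
      using z(1) by blast
  qed
  have pick: "pick Q \<in> topspace X" "pick Q \<notin> \<Union>(U ` Q)" if "\<not> topspace X \<subseteq> \<Union>(U ` Q)" for Q
  proof -
    have "pick Q \<in> topspace X - \<Union>(U ` Q)"
      unfolding pick_def using that by (intro someI_ex[of "\<lambda>x. x \<in> topspace X - \<Union>(U ` Q)"]) blast
    then show "pick Q \<in> topspace X" "pick Q \<notin> \<Union>(U ` Q)"
      by blast+
  qed
  have \<Phi>: "\<Phi> B \<subseteq> topspace X \<and> |\<Phi> B| \<le>o |Pow M|" if B: "B \<subseteq> topspace X" "|B| \<le>o |M|" for B
  proof
    have "Z B \<subseteq> topspace X"
      using Zcl[of B] closure_of_subset_topspace[of X B] by (rule subset_trans)
    moreover have "A z \<subseteq> topspace X" if "z \<in> B" for z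
      using A B that by blast
    moreover have "pick ` W B \<subseteq> topspace X"
      using pick(1) by (auto simp: W_def)
    ultimately show "\<Phi> B \<subseteq> topspace X"
      unfolding \<Phi>_def by blast
    have nB: "|(UNIV :: nat set) \<times> B| \<le>o |M|"
      using MM natM B(2) by (intro card_of_Times_ordLeq_infinite_Field)
    have nM: "|M \<times> (UNIV :: nat set)| \<le>o |M|"
      using MM natM by (intro card_of_Times_ordLeq_infinite_Field) auto
    have "|Z B| \<le>o |code B ` (X closure_of B)|"
      unfolding Z_def by (rule card_of_image)
    also have "|code B ` (X closure_of B)| \<le>o |Pow (M \<times> (UNIV :: nat set) \<times> B)|"
      by (rule card_of_mono1) (auto simp: code_def)
    also have "|Pow (M \<times> (UNIV :: nat set) \<times> B)| \<le>o |Pow M|"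
      using nB by (intro card_of_Pow_Times[OF M]) auto
    finally have "|Z B| \<le>o |Pow M|" .
    moreover have "|\<Union>z\<in>B. A z| \<le>o |Pow M|"
    proof (rule card_of_UNION_ordLeq_infinite_Field)
      show "|B| \<le>o |Pow M|"
        by (rule ordLeq_transitive[OF B(2) MP])
      show "\<forall>z\<in>B. |A z| \<le>o |Pow M|"
        using A B(1) ordLeq_transitive[OF _ MP] by blast
    qed (use PM in auto)
    moreover have "|pick ` W B| \<le>o |Pow M|"
    proof -
      have "|pick ` W B| \<le>o |W B|"
        by (rule card_of_image)
      also have "|W B| \<le>o |Pow (B \<times> M \<times> (UNIV :: nat set))|"
        by (rule card_of_mono1) (auto simp: W_def)
      also have "|Pow (B \<times> M \<times> (UNIV :: nat set))| \<le>o |Pow M|"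
        using nM B(2) by (intro card_of_Pow_Times[OF M])
      finally show ?thesis .
    qed
    ultimately show "|\<Phi> B| \<le>o |Pow M|"
      unfolding \<Phi>_def using PM by (intro card_of_Un_ordLeq_infinite_Field)
  qed
  obtain D where D: "D \<subseteq> topspace X" "|D| \<le>o |Pow M|"
      "\<And>B. B \<subseteq> D \<Longrightarrow> |B| \<le>o |M| \<Longrightarrow> \<Phi> B \<subseteq> D"
    using closing_off[OF M, of "topspace X" \<Phi>] \<Phi> by blast
  define SB where "SB = {B. B \<subseteq> D \<and> |B| \<le>o |M| }"
  \<comment> \<open>The points within reach of \<open>\<Phi>\<close>: each lies in the closure of a
    set to which closing off applies. \<open>nofree\<close> makes \<open>Y\<close> closed, so
    compactness can be used inside it.\<close>
  define Y where "Y = (\<Union>B\<in>SB. X closure_of B)"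
  have clY: "X closure_of B \<subseteq> Y" if "B \<subseteq> D" "|B| \<le>o |M|" for B
    using that by (auto simp: Y_def SB_def)
  have fin_small: "|B| \<le>o |M|" if "finite B" for B :: "'a set"
    using card_of_finite_ordLess[OF MM that] ordLess_imp_ordLeq by blast
  have DY: "D \<subseteq> Y"
  proof
    fix d assume d: "d \<in> D"
    then have "d \<in> X closure_of {d}"
      using D(1) closure_of_subset[of "{d}" X] by blast
    then show "d \<in> Y"
      using clY[of "{d}"] fin_small[of "{d}"] d by blast
  qed
  have YcD: "Y \<subseteq> X closure_of D"
    unfolding Y_def SB_def using closure_of_mono by blast
  have YX: "Y \<subseteq> topspace X"
    using YcD closure_of_subset_topspace[of X D] by (rule subset_trans)
  have Yclosed: "closedin X Y"
  proof (rule closedin_if_small_closures[OF _ _ nofree YX])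
    show "Card_order (cardSuc |M| )"
      by (rule cardSuc_Card_order[OF MM(1)])
    show "infinite (Field (cardSuc |M| ))"
      using M by (simp add: cardSuc_finite)
    fix C assume C: "C \<subseteq> Y" "|C| <o cardSuc |M|"
    have cardC: "|C| \<le>o |M|"
      using C(2) cardSuc_ordLeq_ordLess[OF MM(1) card_of_Card_order] by blast
    have "\<forall>c\<in>C. \<exists>B. B \<in> SB \<and> c \<in> X closure_of B"
      using C(1) by (auto simp: Y_def)
    from bchoice[OF this] obtain b where b: "\<forall>c\<in>C. b c \<in> SB \<and> c \<in> X closure_of (b c)" ..
    define B where "B = (\<Union>c\<in>C. b c)"
    have "|B| \<le>o |M|"
      unfolding B_def
      by (rule card_of_UNION_ordLeq_infinite_Field[OF MM(2,1) cardC]) (use b in \<open>auto simp: SB_def\<close>)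
    moreover have "B \<subseteq> D"
      using b by (auto simp: B_def SB_def)
    moreover have "C \<subseteq> X closure_of B"
    proof
      fix c assume c: "c \<in> C"
      then have "b c \<subseteq> B"
        by (auto simp: B_def)
      then show "c \<in> X closure_of B"
        using b c closure_of_mono by blast
    qed
    then have "X closure_of C \<subseteq> X closure_of B"
      by (intro closure_of_minimal) auto
    ultimately show "X closure_of C \<subseteq> Y"
      using clY by blast
  qed
  have "topspace X \<subseteq> Y"
  proof (rule ccontr)
    assume "\<not> topspace X \<subseteq> Y"
    then obtain q where q: "q \<in> topspace X" "q \<notin> Y"
      by blast
    \<comment> \<open>Finitely many of these neighbourhoods miss \<open>q\<close>, so
      \<open>pick\<close> finds a point of \<open>Y\<close> outside them, and compactness a
      \<open>y \<in> Y\<close> outside all. But some zero set with centre in \<open>D\<close>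
      contains \<open>y\<close> and, lying in \<open>Y\<close>, omits \<open>q\<close>; so a
      neighbourhood with that centre contains \<open>y\<close> and not \<open>q\<close>, a
      contradiction.\<close>
    define I where "I = {i \<in> D \<times> M \<times> UNIV. q \<notin> U i}"
    have opU: "openin X (U i)" if "i \<in> I" for i
      using that D(1) cont by (auto simp: I_def U_def intro!: openin_abs_less)
    obtain y where y: "y \<in> Y" "\<And>i. i \<in> I \<Longrightarrow> y \<in> topspace X - U i"
    proof (rule common_point[OF Yclosed, of I "\<lambda>i. topspace X - U i"])
      fix J assume J: "finite J" "J \<subseteq> I"
      define B where "B = fst ` J"
      have B: "B \<subseteq> D" "|B| \<le>o |M|"
        using J fin_small[of B] by (auto simp: B_def I_def)
      have JW: "\<not> topspace X \<subseteq> \<Union>(U ` J)"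
        using J q(1) by (auto simp: I_def)
      then have "J \<in> W B"
        using J(2) by (force simp: W_def B_def I_def)
      then have "pick J \<in> Y"
        using D(3)[OF B] DY by (auto simp: \<Phi>_def)
      then show "\<exists>x\<in>Y. \<forall>i\<in>J. x \<in> topspace X - U i"
        using pick[OF JW] by blast
    qed (use opU in auto)
    obtain B where B: "B \<subseteq> D" "|B| \<le>o |M|" "y \<in> X closure_of B"
      using y(1) by (auto simp: Y_def SB_def)
    obtain z where z: "z \<in> Z B" "y \<in> zeros X (g z ` M)"
      using Zcover[OF B(3)] by blast
    have zD: "z \<in> D"
      using D(3)[OF B(1,2)] z(1) by (auto simp: \<Phi>_def)
    then have zX: "z \<in> topspace X"
      using D(1) by blast
    have "A z \<subseteq> D"
      using D(3)[of "{z}"] zD fin_small[of "{z}"] by (auto simp: \<Phi>_def)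
    then have "X closure_of A z \<subseteq> Y"
      using clY A[OF zX] by blast
    then have "q \<notin> zeros X (g z ` M)"
      using gA[OF zX] q(2) by blast
    then obtain m where m: "m \<in> M" "g z m q \<noteq> 0"
      using q(1) by (auto simp: zeros_def)
    then obtain n where n: "inverse (real (Suc n)) < \<bar>g z m q\<bar>"
      using reals_Archimedean[of "\<bar>g z m q\<bar>"] by auto
    have "(z, m, n) \<in> I"
      using n zD m by (simp add: I_def U_def inverse_eq_divide add.commute)
    then have "y \<notin> U (z, m, n)"
      using y(2) by blast
    moreover have "y \<in> U (z, m, n)"
      using z(2) m by (simp add: U_def zeros_def)
    ultimately show False
      by blast
  qed
  then have "X closure_of D = topspace X"
    using YcD closure_of_subset_topspace[of X D] by blast
  then show thesis
    using that D(1,2) by blast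
qed

text \<open>
  A homeomorphism moving \<open>p\<close> to \<open>q\<close> is recorded only through one point of \<open>D\<close> in the image of each
  member of a local \<open>\<pi>\<close>-base at \<open>p\<close>; distinct points \<open>q\<close> have distinct records.
\<close>

lemma homogeneous_card_bound:
  assumes hom: "homogeneous_space X" and M: "infinite M"
    and D: "D \<subseteq> topspace X" "|D| \<le>o |Pow M|" "X closure_of D = topspace X"
    and p: "p \<in> topspace X" and P: "local_pi_base X p P" "|P| \<le>o |M|"
  shows "|topspace X| \<le>o |Pow M|"
proof -
  have "\<forall>q\<in>topspace X. \<exists>h. homeomorphic_map X X h \<and> h p = q"
    using hom p by (simp add: homogeneous_space_def)
  from bchoice[OF this] obtain h where h: "\<forall>q\<in>topspace X. homeomorphic_map X X (h q) \<and> h q p = q" ..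
  have dense: "\<exists>d\<in>D. d \<in> h q ` V" if q: "q \<in> topspace X" and V: "V \<in> P" for q V
  proof -
    have V: "openin X V" "V \<noteq> {}"
      using P(1) V by (auto simp: local_pi_base_def)
    then have VX: "V \<subseteq> topspace X" by (simp add: openin_subset)
    have hq: "homeomorphic_map X X (h q)"
      using h q by blast
    have "openin X (h q ` V)"
      using homeomorphic_map_openness[OF hq VX] V(1) by simp
    moreover obtain v where v: "v \<in> V" using V(2) by blast
    ultimately have "h q v \<in> X closure_of D"
      unfolding D(3) using openin_subset[of X "h q ` V"] by blast
    then show ?thesis
      using \<open>openin X (h q ` V)\<close> v unfolding in_closure_of by blast
  qed
  \<comment> \<open>The fixed value off \<open>P\<close> places \<open>c q\<close> in
    \<open>Func P D\<close>.\<close>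
  define c where "c q V = (if V \<in> P then SOME d. d \<in> D \<and> d \<in> h q ` V else undefined)" for q V
  have c: "c q V \<in> D" "c q V \<in> h q ` V" if "q \<in> topspace X" "V \<in> P" for q V
    using someI_ex[of "\<lambda>d. d \<in> D \<and> d \<in> h q ` V"] dense[OF that] that by (auto simp: c_def)
  have "inj_on c (topspace X)"
  proof (rule inj_onI, rule ccontr)
    fix x y assume xy: "x \<in> topspace X" "y \<in> topspace X" "c x = c y" "x \<noteq> y"
    then obtain S T where ST: "openin X S" "openin X T" "x \<in> S" "y \<in> T" "disjnt S T"
      using Hausdorff unfolding Hausdorff_space_def by blast
    \<comment> \<open>A member of \<open>P\<close> inside \<open>N\<close> is sent into
      \<open>S\<close> by \<open>h x\<close> and into \<open>T\<close> by \<open>h y\<close>, so the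
      two records differ there.\<close>
    define N where "N = {z \<in> topspace X. h x z \<in> S} \<inter> {z \<in> topspace X. h y z \<in> T}"
    have "continuous_map X X (h x)" "continuous_map X X (h y)"
      using h xy(1,2) homeomorphic_imp_continuous_map by blast+
    then have "openin X N"
      unfolding N_def using ST by (intro openin_Int openin_continuous_map_preimage)
    moreover have "p \<in> N"
      using ST h xy p by (simp add: N_def)
    ultimately obtain V where V: "V \<in> P" "V \<subseteq> N"
      using P(1) unfolding local_pi_base_def by blast
    have "c x V \<in> S" "c y V \<in> T"
      using c(2)[OF xy(1) V(1)] c(2)[OF xy(2) V(1)] V(2) by (auto simp: N_def)
    then show False
      using xy(3) ST(5) by (simp add: disjnt_iff)
  qed
  moreover have "c ` topspace X \<subseteq> Func P D"
    using c(1) by (auto simp: Func_def c_def)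
  ultimately have "|topspace X| \<le>o |Func P D|"
    by (metis card_of_ordLeq)
  also have "|Func P D| \<le>o |Pow M|"
    by (rule card_of_Func_Pow[OF M P(2) D(2)])
  finally show ?thesis .
qed

end

subsection \<open>Characters\<close>

text \<open>Along an embedding both closures only shrink. So the lengths of free sequences are
  closed downwards, and \<open>F_hat\<close> is a threshold.\<close>

lemma free_sequence_mono:
  assumes le: "r' \<le>o r" and p: "free_sequence X r p"
  shows "\<exists>p'. free_sequence X r' p'"
proof -
  obtain f where r': "Well_order r'" and r: "Well_order r" and f: "embed r' r f"
    using le unfolding ordLeq_def by auto
  have inj: "inj_on f (Field r')"
    by (rule embed_inj_on[OF r' f])
  have fF: "f i \<in> Field r" if "i \<in> Field r'" for i
    using embed_Field[OF f] that by blast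
  have fr: "(f i, f j) \<in> r" if "(i, j) \<in> r'" for i j
    using embed_compat[OF f] that unfolding compat_def by blast
  have "free_sequence X r' (p \<circ> f)"
    unfolding free_sequence_def
  proof (intro conjI ballI)
    fix i assume i: "i \<in> Field r'"
    show "(p \<circ> f) i \<in> topspace X"
      using p fF[OF i] by (simp add: free_sequence_def)
    have "(p \<circ> f) ` {j. (j, i) \<in> r' \<and> j \<noteq> i} \<subseteq> p ` {j. (j, f i) \<in> r \<and> j \<noteq> f i}"
    proof clarify
      fix j assume j: "(j, i) \<in> r'" "j \<noteq> i"
      then have "f j \<noteq> f i"
        using inj i by (auto simp: Field_def dest: inj_onD)
      then show "(p \<circ> f) j \<in> p ` {j. (j, f i) \<in> r \<and> j \<noteq> f i}"
        using fr[OF j(1)] by auto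
    qed
    moreover have "(p \<circ> f) ` {j. (i, j) \<in> r'} \<subseteq> p ` {j. (f i, j) \<in> r}"
      using fr by auto
    moreover have "disjnt (X closure_of (p ` {j. (j, f i) \<in> r \<and> j \<noteq> f i})) (X closure_of (p ` {j. (f i, j) \<in> r}))"
      using p fF[OF i] by (simp add: free_sequence_def)
    ultimately show "disjnt (X closure_of ((p \<circ> f) ` {j. (j, i) \<in> r' \<and> j \<noteq> i}))
        (X closure_of ((p \<circ> f) ` {j. (i, j) \<in> r'}))"
      by (meson closure_of_mono disjnt_subset1 disjnt_subset2)
  qed
  then show ?thesis
    by blast
qed

lemma F_hat_eqI:
  fixes X :: "'a topology" and r :: "'a set rel"
  assumes r: "Card_order r" and free: "free_sequence X r p"
    and nofree: "\<not> (\<exists>p. free_sequence X (cardSuc r) p)"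
  shows "F_hat X =o cardSuc r"
proof -
  note lc = least_card[of "|UNIV :: 'a set set|" "\<lambda>r. \<not> (\<exists>p. free_sequence X r p)",
      OF card_of_Card_order no_free_sequence_card_of_UNIV, folded F_hat_def]
  have wo: "Well_order r" "Well_order (F_hat X)" "Well_order (cardSuc r)"
    using r lc(1) cardSuc_Card_order[OF r] by (auto simp: card_order_on_def)
  have "\<not> F_hat X \<le>o r"
    using free_sequence_mono[OF _ free] lc(2) by blast
  then have "r <o F_hat X"
    using not_ordLeq_iff_ordLess[OF wo(1,2)] by blast
  then have ge: "cardSuc r \<le>o F_hat X"
    by (rule cardSuc_least[OF r lc(1)])
  have "\<not> cardSuc r <o F_hat X"
  proof
    assume less: "cardSuc r <o F_hat X"
    \<comment> \<open>\<open>F_hat X\<close> is minimal only among relations on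
      \<open>'a set\<close>, while \<open>cardSuc r\<close> lives on another type; \<open>S\<close>
      is a copy of the right type.\<close>
    then obtain S where S: "S \<subseteq> Field (F_hat X)" "|Field (cardSuc r)| =o |S|"
      using internalize_card_of_ordLess[THEN iffD1, OF ordLess_Field[OF less]] by blast
    have iso: "|S| =o cardSuc r"
      by (rule ordIso_transitive[OF ordIso_symmetric[OF S(2)] card_of_Field_ordIso[OF cardSuc_Card_order[OF r]]])
    have "\<not> (\<exists>p. free_sequence X |S| p)"
      using free_sequence_mono[OF ordIso_imp_ordLeq[OF ordIso_symmetric[OF iso]]] nofree by blast
    then have "F_hat X \<le>o |S|"
      by (intro lc(3)) auto
    then have "F_hat X \<le>o cardSuc r"
      by (rule ordLeq_ordIso_trans[OF _ iso])
    then show False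
      using not_ordLess_ordLeq[OF less] by contradiction
  qed
  then have "F_hat X \<le>o cardSuc r"
    using not_ordLess_iff_ordLeq[OF wo(2,3)] by blast
  then show ?thesis
    using ge by (simp add: ordIso_iff_ordLeq)
qed

section \<open>Characters under homeomorphisms, and the upper bound for free sequences\<close>

lemma local_base_nbhds: "local_base X p (nbhds X p)"
  unfolding local_base_def by blast

lemma pt_character:
  fixes X :: "'a topology"
  shows Card_order_pt_character: "Card_order (pt_character X p)"
    and pt_character_attained: "\<exists>B. local_base X p B \<and> pt_character X p =o |B|"
    and pt_character_le: "local_base X p B \<Longrightarrow> pt_character X p \<le>o |B|"
proof -
  have *: "\<exists>B. local_base X p B \<and> |nbhds X p| =o |B|"
    by (intro exI[of _ "nbhds X p"] conjI local_base_nbhds card_of_refl)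
  note lc = least_card[of "|nbhds X p|" "\<lambda>r :: 'a set rel. \<exists>B. local_base X p B \<and> r =o |B|",
      OF card_of_Card_order *, folded pt_character_def]
  show "Card_order (pt_character X p)" "\<exists>B. local_base X p B \<and> pt_character X p =o |B|"
    by (rule lc(1), rule lc(2))
  show "pt_character X p \<le>o |B|" if "local_base X p B"
    by (intro lc(3) card_of_Card_order exI[of _ B] conjI that card_of_refl)
qed

lemma character:
  fixes X :: "'a topology"
  shows Card_order_character: "Card_order (character X)"
    and pt_character_le_character: "p \<in> topspace X \<Longrightarrow> pt_character X p \<le>o character X"
    and character_least: "\<And>r :: 'a set rel. Card_order r \<Longrightarrow>
      (\<And>p. p \<in> topspace X \<Longrightarrow> pt_character X p \<le>o r) \<Longrightarrow> character X \<le>o r"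
proof -
  have *: "\<forall>p\<in>topspace X. pt_character X p \<le>o |UNIV :: 'a set set|"
    by (intro ballI ordLeq_transitive[OF pt_character_le[OF local_base_nbhds] card_of_mono1[OF subset_UNIV]])
  note lc = least_card[of "|UNIV :: 'a set set|" "\<lambda>r. \<forall>p\<in>topspace X. pt_character X p \<le>o r",
      OF card_of_Card_order *, folded character_def]
  show "Card_order (character X)"
    by (rule lc(1))
  show "pt_character X p \<le>o character X" if "p \<in> topspace X"
    using lc(2) that by blast
  show "character X \<le>o r" if "Card_order r" "\<And>p. p \<in> topspace X \<Longrightarrow> pt_character X p \<le>o r" for r :: "'a set rel"
  proof (rule lc(3)[OF that(1)])
    show "\<forall>p\<in>topspace X. pt_character X p \<le>o r"
      using that(2) by blast
  qed
qed

lemma local_base_homeomorphic_image: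
  assumes h: "homeomorphic_map X X h" and p: "p \<in> topspace X" and B: "local_base X p B"
  shows "local_base X (h p) ((`) h ` B)"
proof -
  have onto: "h ` topspace X = topspace X" and inj: "inj_on h (topspace X)"
    using h by (auto simp: homeomorphic_eq_everything_map)
  have image: "h ` N \<in> nbhds X (h p)" if "N \<in> nbhds X p" for N
  proof -
    have N: "N \<subseteq> topspace X" "p \<in> X interior_of N"
      using that by (auto simp: nbhds_def)
    then show ?thesis
      using homeomorphic_map_interior_of[OF h N(1)] onto by (auto simp: nbhds_def)
  qed
  show ?thesis
    unfolding local_base_def
  proof (intro conjI ballI)
    show "(`) h ` B \<subseteq> nbhds X (h p)"
      using B image by (auto simp: local_base_def)
    fix N assume N: "N \<in> nbhds X (h p)"
    define N' where "N' = {x \<in> topspace X. h x \<in> N}"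
    have NX: "N \<subseteq> topspace X"
      using N by (simp add: nbhds_def)
    then have hN': "h ` N' = N"
      using onto by (auto simp: N'_def)
    have N'X: "N' \<subseteq> topspace X"
      by (auto simp: N'_def)
    have "h p \<in> h ` (X interior_of N')"
      using N homeomorphic_map_interior_of[OF h N'X] by (simp add: hN' nbhds_def)
    then have "p \<in> X interior_of N'"
      using inj p interior_of_subset_topspace[of X N'] by (auto dest: inj_onD)
    then have "N' \<in> nbhds X p"
      using N'X by (simp add: nbhds_def)
    then obtain V where "V \<in> B" "V \<subseteq> N'"
      using B by (auto simp: local_base_def)
    then show "\<exists>V\<in>(`) h ` B. V \<subseteq> N"
      using hN' by (intro bexI[of _ "h ` V"]) auto
  qed
qed

lemma pt_character_homogeneous:
  assumes hom: "homogeneous_space X" and p: "p \<in> topspace X"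
  shows "pt_character X p =o character X"
proof -
  have "pt_character X q \<le>o pt_character X p" if q: "q \<in> topspace X" for q
  proof -
    obtain h where h: "homeomorphic_map X X h" "h p = q"
      using hom p q by (auto simp: homogeneous_space_def)
    obtain B where B: "local_base X p B" "pt_character X p =o |B|"
      using pt_character_attained[of X p] by blast
    have "pt_character X q \<le>o |(`) h ` B|"
      using pt_character_le[OF local_base_homeomorphic_image[OF h(1) p B(1)]] h(2) by simp
    also have "|(`) h ` B| \<le>o |B|"
      by (rule card_of_image)
    also have "|B| =o pt_character X p"
      by (rule ordIso_symmetric[OF B(2)])
    finally show ?thesis .
  qed
  then have "character X \<le>o pt_character X p"
    by (intro character_least Card_order_pt_character)
  then show ?thesis
    using pt_character_le_character[OF p] by (simp add: ordIso_iff_ordLeq)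
qed

lemma no_long_free_sequence:
  assumes X: "compact_space X" and r: "Card_order r" "infinite (Field r)"
    and base: "\<And>p. p \<in> topspace X \<Longrightarrow> \<exists>B. local_base X p B \<and> |B| \<le>o r"
  shows "\<not> (\<exists>p. free_sequence X (cardSuc r) p)"
proof
  assume "\<exists>p. free_sequence X (cardSuc r) p"
  then obtain p where p: "free_sequence X (cardSuc r) p" ..
  define s where "s = cardSuc r"
  have s: "Card_order s" "infinite (Field s)"
    using r by (auto simp: s_def cardSuc_Card_order cardSuc_finite)
  have wo: "Well_order s"
    using s(1) by (simp add: card_order_on_def)
  have pX: "p i \<in> topspace X" if "i \<in> Field s" for i
    using p that by (simp add: free_sequence_def s_def)
  define C where "C i = X closure_of (p ` {j. (i, j) \<in> s})" for i
  have pC: "p j \<in> C i" if "(i, j) \<in> s" for i j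
  proof -
    have "p ` {j. (i, j) \<in> s} \<subseteq> topspace X"
      using pX by (auto simp: Field_def)
    then show ?thesis
      using closure_of_subset that unfolding C_def by fastforce
  qed
  have "\<Inter>(C ` Field s) \<noteq> {}"
  proof (rule X[unfolded compact_space_fip, rule_format], intro conjI ballI allI impI)
    fix F assume F: "finite F \<and> F \<subseteq> C ` Field s"
    then obtain J where J: "J \<subseteq> Field s" "finite J" "F = C ` J"
      by (meson finite_subset_image)
    show "\<Inter>F \<noteq> {}"
    proof (cases "J = {}")
      case False
      obtain k where "k \<in> J" "\<And>j. j \<in> J \<Longrightarrow> (j, k) \<in> s"
        using finite_has_greatest[OF wo J(2) False J(1)] by blast
      then have "p k \<in> \<Inter>F"
        using pC J(3) by blast
      then show ?thesis by blast
    qed (use J in simp)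
  qed (auto simp: C_def)
  then obtain q where q: "\<And>i. i \<in> Field s \<Longrightarrow> q \<in> C i"
    by blast
  \<comment> \<open>There is no last index, so the proper initial segments exhaust the
    field.\<close>
  have limit: "\<exists>j. j \<in> Field s \<and> i \<in> underS s j" if "i \<in> Field s" for i
    using infinite_Card_order_limit[OF s that] by (auto simp: underS_def)
  have "Field s \<noteq> {}"
    using s(2) by auto
  then obtain i0 where i0: "i0 \<in> Field s"
    by blast
  have qX: "q \<in> topspace X"
    using q[OF i0] unfolding C_def by (rule subsetD[OF closure_of_subset_topspace])
  obtain B where B: "local_base X q B" "|B| \<le>o r"
    using base[OF qX] by blast
  have "\<forall>V\<in>B. \<exists>j. j \<in> Field s \<and> p j \<in> V"
  proof
    fix V assume "V \<in> B"
    then have V: "q \<in> X interior_of V"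
      using B(1) by (auto simp: local_base_def nbhds_def)
    have "q \<in> X closure_of (p ` {j. (i0, j) \<in> s})"
      using q[OF i0] by (simp add: C_def)
    then obtain y where "y \<in> p ` {j. (i0, j) \<in> s}" "y \<in> X interior_of V"
      using V openin_interior_of[of X V] unfolding in_closure_of by blast
    then show "\<exists>j. j \<in> Field s \<and> p j \<in> V"
      using interior_of_subset[of X V] by (auto simp: Field_def)
  qed
  from bchoice[OF this] obtain k where k: "\<forall>V\<in>B. k V \<in> Field s \<and> p (k V) \<in> V" ..
  have "|k ` B| \<le>o r"
    by (rule ordLeq_transitive[OF card_of_image B(2)])
  moreover have "k ` B \<subseteq> (\<Union>i\<in>Field s. underS s i)"
    using k limit by blast
  moreover have "relChain s (underS s)"
    unfolding relChain_def
  proof (intro allI impI)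
    fix i j assume "(i, j) \<in> s"
    then show "underS s i \<subseteq> underS s j"
      using wo unfolding order_on_defs by (intro underS_incr) auto
  qed
  \<comment> \<open>Successor cardinals are regular, so the at most \<open>r\<close> chosen indices
    lie below some \<open>i\<close>. Thus \<open>q\<close> is in the closure of the points before
    \<open>i\<close> as well as of those from \<open>i\<close> on.\<close>
  ultimately obtain i where i: "i \<in> Field s" "k ` B \<subseteq> underS s i"
    using cardSuc_UNION[OF r, of "underS s" "k ` B"] unfolding s_def by blast
  have "q \<in> X closure_of (p ` underS s i)"
    unfolding in_closure_of
  proof (intro conjI allI impI qX)
    fix T assume T: "q \<in> T \<and> openin X T"
    then have "T \<in> nbhds X q"
      by (simp add: nbhds_def interior_of_openin openin_subset)
    then obtain V where "V \<in> B" "V \<subseteq> T"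
      using B(1) by (auto simp: local_base_def)
    then show "\<exists>y. y \<in> p ` underS s i \<and> y \<in> T"
      using k i(2) by blast
  qed
  moreover have "underS s i = {j. (j, i) \<in> s \<and> j \<noteq> i}"
    by (auto simp: underS_def)
  moreover have "q \<in> X closure_of (p ` {j. (i, j) \<in> s})"
    using q[OF i(1)] by (simp add: C_def)
  ultimately show False
    using p i(1) unfolding free_sequence_def s_def disjnt_iff by auto
qed

section \<open>Infinite homogeneous compacta: a free sequence of length the character\<close>

context compactum
begin

lemma isolated_if_finite_local_base:
  assumes p: "p \<in> topspace X" and B: "local_base X p B" "finite B"
  shows "openin X {p}"
proof -
  define W where "W = topspace X \<inter> (\<Inter>V\<in>B. X interior_of V)"
  have "openin X W"
    unfolding W_def using B(2) by (cases "B = {}") (auto intro!: openin_Int openin_INT)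
  moreover have "W = {p}"
  proof (rule subset_antisym; rule subsetI)
    fix y assume y: "y \<in> W"
    show "y \<in> {p}"
    proof (rule ccontr)
      assume "y \<notin> {p}"
      have N: "openin X (topspace X - {y})"
        using closedin_Hausdorff_singleton[OF Hausdorff, of y] y by (auto simp: W_def)
      then have "topspace X - {y} \<in> nbhds X p"
        using p \<open>y \<notin> {p}\<close> by (auto simp: nbhds_def interior_of_openin)
      then obtain V where "V \<in> B" "V \<subseteq> topspace X - {y}"
        using B(1) by (auto simp: local_base_def)
      then show False
        using y interior_of_subset[of X V] by (auto simp: W_def)
    qed
  qed (use B(1) p in \<open>auto simp: W_def local_base_def nbhds_def\<close>)
  ultimately show ?thesis by simp
qed

text \<open>If \<open>p\<close> were not isolated, every member would contain a point other than
  \<open>p\<close>; removing finitely many such points leaves a neighbourhood of \<open>p\<close>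
  that includes no member.\<close>

lemma isolated_if_finite_local_pi_base:
  assumes p: "p \<in> topspace X" and P: "local_pi_base X p P" "finite P"
  shows "openin X {p}"
proof (rule ccontr)
  assume nop: "\<not> openin X {p}"
  have "\<forall>V\<in>P. \<exists>x. x \<in> V \<and> x \<noteq> p"
  proof
    fix V assume "V \<in> P"
    then have V: "openin X V" "V \<noteq> {}"
      using P(1) by (auto simp: local_pi_base_def)
    then have "V \<noteq> {p}"
      using nop by auto
    then show "\<exists>x. x \<in> V \<and> x \<noteq> p"
      using V(2) by blast
  qed
  from bchoice[OF this] obtain x where x: "\<forall>V\<in>P. x V \<in> V \<and> x V \<noteq> p" ..
  have "x V \<in> topspace X" if "V \<in> P" for V
    using x P(1) that openin_subset[of X V] by (auto simp: local_pi_base_def)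
  then have "closedin X (\<Union>V\<in>P. {x V})"
    using P(2) closedin_Hausdorff_singleton[OF Hausdorff] by (intro closedin_Union) auto
  then have "openin X (topspace X - (\<Union>V\<in>P. {x V}))"
    by auto
  moreover have "p \<in> topspace X - (\<Union>V\<in>P. {x V})"
    using p x by auto
  ultimately obtain V where "V \<in> P" "V \<subseteq> topspace X - (\<Union>V\<in>P. {x V})"
    using P(1) unfolding local_pi_base_def by blast
  then show False
    using x by blast
qed

text \<open>A finite character would isolate every point, and a discrete compactum is
  finite.\<close>

lemma infinite_character:
  assumes hom: "homogeneous_space X" and inf: "infinite (topspace X)"
  shows "infinite (Field (character X))"
proof
  assume fin: "finite (Field (character X))"
  have "openin X {p}" if p: "p \<in> topspace X" for p
  proof -
    obtain B where B: "local_base X p B" "pt_character X p =o |B|"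
      using pt_character_attained[of X p] by blast
    have "|B| \<le>o character X"
      using ordIso_ordLeq_trans[OF ordIso_symmetric[OF B(2)] pt_character_le_character[OF p]] .
    also have "character X =o |Field (character X)|"
      by (rule ordIso_symmetric[OF card_of_Field_ordIso[OF Card_order_character]])
    finally have "finite B"
      using card_of_ordLeq_finite fin by blast
    then show ?thesis
      by (rule isolated_if_finite_local_base[OF p B(1)])
  qed
  then have "X = discrete_topology (topspace X)"
    by (metis discrete_topology_unique)
  then have "finite (topspace X)"
    using compact compact_space_discrete_topology by metis
  then show False
    using inf by simp
qed

lemma free_sequence_character:
  assumes gch: "GCH TYPE('a set)" and hom: "homogeneous_space X" and inf: "infinite (topspace X)"
  shows "\<exists>x. free_sequence X (character X) x"
proof (rule ccontr)
  assume nofree: "\<not> (\<exists>x. free_sequence X (character X) x)"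
  define \<kappa> where "\<kappa> = character X"
  have \<kappa>: "Card_order \<kappa>" "infinite (Field \<kappa>)"
    unfolding \<kappa>_def using Card_order_character infinite_character[OF hom inf] by auto
  have ne: "topspace X \<noteq> {}"
    using inf by auto
  then obtain p where p: "p \<in> topspace X"
    by blast
  have large: "\<kappa> \<le>o |B|" if "q \<in> topspace X" "local_base X q B" for q B
    unfolding \<kappa>_def
    by (rule ordIso_ordLeq_trans[OF ordIso_symmetric[OF pt_character_homogeneous[OF hom that(1)]]
          pt_character_le[OF that(2)]])
  have notopen: "\<not> openin X {p}"
  proof
    assume "openin X {p}"
    then have "local_base X p {{p}}"
      using p by (auto simp: local_base_def nbhds_def interior_of_openin dest: subsetD[OF interior_of_subset])
    then have "\<kappa> \<le>o |{{p}}|"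
      by (rule large[OF p])
    moreover have "|{{p}}| <o \<kappa>"
      by (rule card_of_finite_ordLess[OF \<kappa>]) simp
    ultimately show False
      using not_ordLess_ordLeq by metis
  qed
  obtain P where P: "local_pi_base X p P" "|P| <o \<kappa>"
    using free_sequence_of_pi_character[OF \<kappa> p] nofree unfolding \<kappa>_def by blast
  \<comment> \<open>An infinite set of size below \<kappa> makes \<kappa> uncountable, as
    \<open>cech_pospisil\<close> requires.\<close>
  have "infinite P"
    using isolated_if_finite_local_pi_base[OF p P(1)] notopen by blast
  then have unc: "|UNIV :: nat set| <o \<kappa>"
    using P(2) ordLeq_ordLess_trans unfolding infinite_iff_card_of_nat by blast
  obtain G A where G: "\<And>g. g \<in> G \<Longrightarrow> continuous_map X euclideanreal g" "|G| <o \<kappa>"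
    and A: "A \<subseteq> topspace X" "|A| <o \<kappa>" and GA: "zeros X G \<noteq> {}" "zeros X G \<subseteq> X closure_of A"
    using small_zeros_in_small_closure[OF \<kappa> ne] nofree unfolding \<kappa>_def by blast
  obtain x0 where x0: "x0 \<in> zeros X G"
    using GA(1) by blast
  then have x0X: "x0 \<in> topspace X"
    by (simp add: zeros_def)
  have PGA: "|P <+> (G <+> A)| <o \<kappa>"
    by (intro card_of_Plus_ordLess_infinite_Field \<kappa> P(2) G(2) A(2))
  \<comment> \<open>One index set of size \<mu>, at least as large as \<open>P\<close>,
    \<open>G\<close> and \<open>A\<close>, copied into the type at which \<open>GCH\<close> is
    assumed.\<close>
  then obtain M :: "'a set set" where M: "|P <+> (G <+> A)| =o |M|" "|M| <o \<kappa>"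
    using internalize_card_of_ordLess[THEN iffD1, OF PGA] by blast
  have le: "|P| \<le>o |M|" "|G| \<le>o |M|" "|A| \<le>o |M|"
    by (rule ordLeq_ordIso_trans[OF card_of_Plus1 M(1)],
        rule ordLeq_ordIso_trans[OF ordLeq_transitive[OF card_of_Plus1 card_of_Plus2] M(1)],
        rule ordLeq_ordIso_trans[OF ordLeq_transitive[OF card_of_Plus2 card_of_Plus2] M(1)])
  have infM: "infinite M"
    using \<open>infinite P\<close> le(1) card_of_ordLeq_infinite by blast
  have gchM: "|Pow M| =o cardSuc |M|"
    using gch infM by (simp add: GCH_def)
  obtain B where B: "local_base X x0 B" "|B| \<le>o |Pow M|"
    using local_base_in_zeros[OF infM G(1) le(2) A(1) le(3) GA(2) x0] by blast
  have sM: "cardSuc |M| \<le>o \<kappa>"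
    by (rule cardSuc_least[OF card_of_Card_order \<kappa>(1) M(2)])
  have "\<kappa> \<le>o |Pow M|"
    by (rule ordLeq_transitive[OF large[OF x0X B(1)] B(2)])
  then have "\<kappa> \<le>o cardSuc |M|"
    by (rule ordLeq_ordIso_trans[OF _ gchM])
  then have nofreeM: "\<not> (\<exists>x. free_sequence X (cardSuc |M| ) x)"
    using free_sequence_mono[of \<kappa> "cardSuc |M|"] nofree unfolding \<kappa>_def by blast
  \<comment> \<open>\<open>G\<close> is reindexed by \<open>M\<close>. An empty \<open>G\<close> is
    no image of \<open>M\<close>, but the zero function has the same zero set, the whole
    space.\<close>
  obtain e where e: "\<And>m. m \<in> M \<Longrightarrow> continuous_map X euclideanreal (e m)" "zeros X (e ` M) = zeros X G"
  proof (cases "G = {}")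
    case True
    then show thesis
      by (intro that[of "\<lambda>m x. 0"]) (auto simp: zeros_def)
  next
    case False
    then obtain e where "e ` M = G"
      using le(2) card_of_ordLeq2 by metis
    then show thesis
      using that[of e] G(1) by auto
  qed
  \<comment> \<open>The first map, sending \<open>q\<close> to \<open>x0\<close>, pulls the
    functions back; its inverse carries \<open>A\<close> over. This gives a copy of the zero set
    through every point.\<close>
  have "\<forall>q\<in>topspace X. \<exists>hk. homeomorphic_maps X X (fst hk) (snd hk) \<and> fst hk q = x0"
  proof
    fix q assume "q \<in> topspace X"
    then obtain h where "homeomorphic_map X X h" "h q = x0"
      using hom x0X by (auto simp: homogeneous_space_def)
    then obtain k where "homeomorphic_maps X X h k" "h q = x0"
      by (auto simp: homeomorphic_map_maps)
    then show "\<exists>hk. homeomorphic_maps X X (fst hk) (snd hk) \<and> fst hk q = x0"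
      by (intro exI[of _ "(h, k)"]) auto
  qed
  from bchoice[OF this] obtain hk where
    hk: "\<forall>q\<in>topspace X. homeomorphic_maps X X (fst (hk q)) (snd (hk q)) \<and> fst (hk q) q = x0" ..
  obtain D where D: "D \<subseteq> topspace X" "|D| \<le>o |Pow M|" "X closure_of D = topspace X"
  proof (rule small_dense_set[OF infM nofreeM, of "\<lambda>q m. e m \<circ> fst (hk q)" "\<lambda>q. snd (hk q) ` A"])
    fix q m assume q: "q \<in> topspace X" and m: "m \<in> M"
    show "continuous_map X euclideanreal (e m \<circ> fst (hk q))"
      using hk q e(1)[OF m] by (auto simp: homeomorphic_maps_def intro: continuous_map_compose)
    show "(e m \<circ> fst (hk q)) q = 0"
      using x0 hk q m e(2) by (auto simp: zeros_def)
  next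
    fix q assume q: "q \<in> topspace X"
    define h k where "h = fst (hk q)" and "k = snd (hk q)"
    have hkq: "homeomorphic_maps X X h k"
      using hk q by (simp add: h_def k_def)
    have kmap: "homeomorphic_map X X k"
      using hkq by (simp add: homeomorphic_maps_map)
    have kh: "k (h x) = x" "h x \<in> topspace X" if "x \<in> topspace X" for x
      using hkq that by (auto simp: homeomorphic_maps_def continuous_map_def)
    have kA: "k ` A \<subseteq> topspace X"
      using A(1) homeomorphic_imp_surjective_map[OF kmap] by blast
    have "|k ` A| \<le>o |M|"
      by (rule ordLeq_transitive[OF card_of_image le(3)])
    then show "snd (hk q) ` A \<subseteq> topspace X \<and> |snd (hk q) ` A| \<le>o |M|"
      using kA by (simp add: k_def)
    have "x \<in> X closure_of (k ` A)" if x: "x \<in> zeros X ((\<lambda>m. e m \<circ> h) ` M)" for x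
    proof -
      have xX: "x \<in> topspace X"
        using x by (simp add: zeros_def)
      then have "h x \<in> zeros X (e ` M)"
        using x kh(2) by (simp add: zeros_def)
      then have "h x \<in> X closure_of A"
        using e(2) GA(2) by blast
      then have "k (h x) \<in> X closure_of (k ` A)"
        using homeomorphic_map_closure_of[OF kmap A(1)] by blast
      then show ?thesis
        using kh(1)[OF xX] by simp
    qed
    then show "zeros X ((\<lambda>m. e m \<circ> fst (hk q)) ` M) \<subseteq> X closure_of (snd (hk q) ` A)"
      by (auto simp: h_def k_def)
  qed
  have "|topspace X| \<le>o cardSuc |M|"
    by (rule ordLeq_ordIso_trans[OF homogeneous_card_bound[OF hom infM D p P(1) le(1)] gchM])
  then have "|topspace X| \<le>o \<kappa>"
    by (rule ordLeq_transitive[OF _ sM])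
  then obtain q C where "q \<in> topspace X" "local_base X q C" "|C| <o \<kappa>"
    using cech_pospisil[OF \<kappa>(1) unc ne] by blast
  then show False
    using large not_ordLess_ordLeq by metis
qed

end

text \<open>The supremum over no points is 0, and the only neighbourhood of an only point is the
  whole space, which gives 1.\<close>

lemma character_of_small_space:
  fixes X :: "'a topology"
  assumes fin: "finite (topspace X)" and card: "card (topspace X) \<le> 1"
  shows "character X =o |topspace X|"
proof -
  consider "topspace X = {}" | p where "topspace X = {p}"
    using fin card by (metis One_nat_def card_1_singletonE card_eq_0_iff le_Suc_eq le_zero_eq)
  then show ?thesis
  proof cases
    case 1
    then have "character X \<le>o |{} :: 'a set set|"
      by (intro character_least) auto
    also have "|{} :: 'a set set| \<le>o |topspace X|"
      by (rule card_of_empty)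
    finally have "character X \<le>o |topspace X|" .
    moreover have "|topspace X| \<le>o character X"
      unfolding 1 by (rule card_of_empty1[OF disjI2[OF Card_order_character]])
    ultimately show ?thesis
      by (simp add: ordIso_iff_ordLeq)
  next
    case 2
    then have p: "p \<in> topspace X" by simp
    have top: "topspace X \<in> nbhds X p"
      using p by (simp add: nbhds_def)
    have eq: "N = topspace X" if "N \<in> nbhds X p" for N
      using that 2 interior_of_subset[of X N] by (auto simp: nbhds_def)
    have "local_base X p {topspace X}"
      unfolding local_base_def
    proof (intro conjI ballI)
      show "\<exists>V\<in>{topspace X}. V \<subseteq> N" if "N \<in> nbhds X p" for N
        using eq[OF that] by simp
    qed (use top in simp)
    then have "pt_character X p \<le>o |{topspace X}|"
      by (rule pt_character_le)
    then have "character X \<le>o |{topspace X}|"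
      using 2 by (intro character_least) auto
    also have "|{topspace X}| \<le>o |topspace X|"
      unfolding 2 by (rule card_of_singl_ordLeq) simp
    finally have "character X \<le>o |topspace X|" .
    obtain B where B: "local_base X p B" "pt_character X p =o |B|"
      using pt_character_attained[of X p] by blast
    then have "B \<noteq> {}"
      using top unfolding local_base_def by blast
    then have "|topspace X| \<le>o |B|"
      unfolding 2 by (rule card_of_singl_ordLeq)
    also have "|B| =o pt_character X p"
      by (rule ordIso_symmetric[OF B(2)])
    also have "pt_character X p \<le>o character X"
      by (rule pt_character_le_character[OF p])
    finally show ?thesis
      using \<open>character X \<le>o |topspace X|\<close> by (simp add: ordIso_iff_ordLeq)
  qed
qed

text \<open>A discrete space with n points, n at least 2, is a homogeneous compactum of character 1
  whose \<open>F_hat\<close> is n + 1, which explains the restriction on finite spaces.\<close>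

theorem corollary3p19:
  fixes X :: "'a topology"
  assumes "GCH TYPE('a set)"
    and "compact_space X" and "Hausdorff_space X"
    and "homogeneous_space X"
    and "finite (topspace X) \<longrightarrow> card (topspace X) \<le> 1"
  shows "F_hat X =o cardSuc (character X)"
proof -
  interpret compactum X
    using assms by unfold_locales
  show ?thesis
  proof (cases "finite (topspace X)")
    case True
    then have iso: "character X =o |topspace X|"
      using assms(5) by (intro character_of_small_space) auto
    have "free_sequence X |topspace X| id"
    proof -
      have empty: "{j. (j, i) \<in> |topspace X| \<and> j \<noteq> i} = {}" if "i \<in> topspace X" for i
      proof -
        have "j = i" if "j \<in> topspace X" for j
          using True assms(5) \<open>i \<in> topspace X\<close> that by (auto simp: card_le_Suc0_iff_eq)
        moreover have "j \<in> topspace X" if "(j, i) \<in> |topspace X|" for j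
          using FieldI1[OF that] by simp
        ultimately show ?thesis by blast
      qed
      show ?thesis
        unfolding free_sequence_def Field_card_of
      proof (intro conjI ballI)
        fix i assume i: "i \<in> topspace X"
        show "disjnt (X closure_of id ` {j. (j, i) \<in> |topspace X| \<and> j \<noteq> i})
            (X closure_of id ` {j. (i, j) \<in> |topspace X| })"
          by (simp only: empty[OF i] image_empty closure_of_empty disjnt_empty1)
      qed simp
    qed
    then obtain x where x: "free_sequence X (character X) x"
      using free_sequence_mono[OF ordIso_imp_ordLeq[OF iso]] by blast
    \<comment> \<open>Free sequences are injective, and here the successor exceeds the number of
      points.\<close>
    have "\<not> free_sequence X (cardSuc (character X)) y" for y
    proof
      assume y: "free_sequence X (cardSuc (character X)) y"
      have C: "Card_order (cardSuc (character X))"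
        by (rule cardSuc_Card_order[OF Card_order_character])
      then have "inj_on y (Field (cardSuc (character X)))"
        using y by (intro free_sequence_inj_on) (auto simp: card_order_on_def)
      moreover have "y ` Field (cardSuc (character X)) \<subseteq> topspace X"
        using y by (auto simp: free_sequence_def)
      ultimately have "|Field (cardSuc (character X))| \<le>o |topspace X|"
        by (metis card_of_ordLeq)
      then have "cardSuc (character X) \<le>o character X"
        by (rule ordIso_ordLeq_trans[OF ordIso_symmetric[OF card_of_Field_ordIso[OF C]]
              ordLeq_ordIso_trans[OF _ ordIso_symmetric[OF iso]]])
      then show False
        using not_ordLess_ordLeq[OF cardSuc_greater[OF Card_order_character]] by contradiction
    qed
    then show ?thesis
      using F_hat_eqI[OF Card_order_character x] by blast
  next
    case False
    have "\<exists>B. local_base X p B \<and> |B| \<le>o character X" if "p \<in> topspace X" for p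
    proof -
      obtain B where B: "local_base X p B" "pt_character X p =o |B|"
        using pt_character_attained[of X p] by blast
      then show ?thesis
        using ordIso_ordLeq_trans[OF ordIso_symmetric[OF B(2)] pt_character_le_character[OF that]] by blast
    qed
    then have "\<not> (\<exists>x. free_sequence X (cardSuc (character X)) x)"
      by (intro no_long_free_sequence compact Card_order_character infinite_character assms(4) False)
    moreover obtain x where "free_sequence X (character X) x"
      using free_sequence_character[OF assms(1,4) False] by blast
    ultimately show ?thesis
      using F_hat_eqI[OF Card_order_character] by blast
  qed
qed

end
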